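(* Let $1\le m<n$ be integers, let $\omega$ be a bounded open subset of $\mathbb{R}^{n-m}$, and let $\Omega_\infty=\mathbb{R}^m\times\omega\subset\mathbb{R}^n$. Then for every $0<s<1$, $$P^2_{n,s}(\Omega_\infty)=P^2_{n-m,s}(\omega).$$
   Context: For an integer $n\ge1$ and $0<s<1$ set $C_{n,s}=\dfrac{s\,2^{2s}\,\Gamma\left(\frac{n+2s}{2}\right)}{\pi^{n/2}\,\Gamma(1-s)}$ and $[u]_{s,2,\mathbb{R}^n}=\left(\frac{C_{n,s}}{2}\int_{\mathbb{R}^n}\int_{\mathbb{R}^n}\frac{|u(x)-u(y)|^2}{|x-y|^{n+2s}}\,dx\,dy\right)^{1/2}$. For an open set $\Omega\subset\mathbb{R}^n$ let $H^s_\Omega(\mathbb{R}^n)$ be the closure of $C_c^\infty(\Omega)$ (functions extended by zero to $\mathbb{R}^n$) in the norm $\left(\|u\|_{L^2(\Omega)}^2+[u]_{s,2,\mathbb{R}^n}^2\right)^{1/2}$. Define the fractional Poincaré constant $$P^2_{n,s}(\Omega)=\inf_{u\in H^s_\Omega(\mathbb{R}^n),\,u\neq0}\frac{[u]_{s,2,\mathbb{R}^n}^2}{\int_\Omega u^2}.$$ *)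

theory Defs
  imports "HOL-Analysis.Analysis"
begin

text \<open>
  The space \<open>\<real>\<^sup>n\<close> is any type of class \<open>euclidean_space\<close> of dimension \<open>n\<close>. The energies and
  quotients below take values in \<^typ>\<open>ennreal\<close>: they may be infinite, and the infimum over an
  empty set of competitors is \<open>\<infinity>\<close>.
\<close>

definition C_const :: "nat \<Rightarrow> real \<Rightarrow> real" where
  "C_const n s =
     s * 2 powr (2 * s) * Gamma ((real n + 2 * s) / 2) / (pi powr (real n / 2) * Gamma (1 - s))"

definition ennreal_sqrt :: "ennreal \<Rightarrow> ennreal" where
  "ennreal_sqrt x = (if x = \<infinity> then \<infinity> else ennreal (sqrt (enn2real x)))"

text \<open>On the diagonal the integrand is \<open>0 / 0 = 0\<close>; the diagonal is a null set.\<close>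

definition gagliardo_seminorm :: "real \<Rightarrow> ('a::euclidean_space \<Rightarrow> real) \<Rightarrow> ennreal" where
  "gagliardo_seminorm s u =
     ennreal_sqrt (ennreal (C_const DIM('a) s / 2) *
       (\<integral>\<^sup>+y. \<integral>\<^sup>+x. ennreal (\<bar>u x - u y\<bar>\<^sup>2 / norm (x - y) powr (real DIM('a) + 2 * s))
          \<partial>lborel \<partial>lborel))"

definition L2_sq_on :: "'a::euclidean_space set \<Rightarrow> ('a \<Rightarrow> real) \<Rightarrow> ennreal" where
  "L2_sq_on \<Omega> u = (\<integral>\<^sup>+x\<in>\<Omega>. ennreal ((u x)\<^sup>2) \<partial>lborel)"

definition Hs_norm :: "real \<Rightarrow> 'a::euclidean_space set \<Rightarrow> ('a \<Rightarrow> real) \<Rightarrow> ennreal" where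
  "Hs_norm s \<Omega> u = ennreal_sqrt (L2_sq_on \<Omega> u + (gagliardo_seminorm s u)\<^sup>2)"

text \<open>
  \<open>k_times_differentiable k u\<close>: all iterated directional derivatives of \<open>u\<close> of order less than
  \<open>k\<close> exist and are (totally) differentiable. For all \<open>k\<close> together this is \<open>C\<^sup>\<infinity>\<close>.
\<close>

primrec k_times_differentiable :: "nat \<Rightarrow> ('a::euclidean_space \<Rightarrow> real) \<Rightarrow> bool" where
  "k_times_differentiable 0 u \<longleftrightarrow> True"
| "k_times_differentiable (Suc k) u \<longleftrightarrow>
     (\<forall>x. u differentiable (at x)) \<and>
     (\<forall>v. k_times_differentiable k (\<lambda>x. frechet_derivative u (at x) v))"

definition Cc_infinity :: "'a::euclidean_space set \<Rightarrow> ('a \<Rightarrow> real) set" where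
  "Cc_infinity \<Omega> = {u. (\<forall>k. k_times_differentiable k u) \<and>
                        compact (closure {x. u x \<noteq> 0}) \<and> closure {x. u x \<noteq> 0} \<subseteq> \<Omega>}"

text \<open>
  Elements are Borel representatives of classes modulo equality almost everywhere. The ambient
  space consists of functions on \<open>\<Omega>\<close> extended by zero. The vanishing condition excludes only the
  nonzero constants in the degenerate case \<open>\<Omega> = {}\<close>: for nonempty open \<open>\<Omega>\<close> it already follows
  from approximability, since the seminorm sees all of \<open>\<real>\<^sup>n\<close>.
\<close>

definition Hs_space :: "real \<Rightarrow> 'a::euclidean_space set \<Rightarrow> ('a \<Rightarrow> real) set" where
  "Hs_space s \<Omega> = {u. u \<in> borel_measurable borel \<and> (AE x in lborel. x \<notin> \<Omega> \<longrightarrow> u x = 0) \<and>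
                      (\<forall>\<epsilon>>0. \<exists>\<phi>\<in>Cc_infinity \<Omega>. Hs_norm s \<Omega> (\<lambda>x. u x - \<phi> x) < \<epsilon>)}"

text \<open>Here \<open>u \<noteq> 0\<close> means nonzero as a class, i.e. not almost everywhere zero.\<close>

definition poincare_sq :: "real \<Rightarrow> 'a::euclidean_space set \<Rightarrow> ennreal" where
  "poincare_sq s \<Omega> = (INF u\<in>{u \<in> Hs_space s \<Omega>. \<not> (AE x in lborel. u x = 0)}.
                         (gagliardo_seminorm s u)\<^sup>2 / L2_sq_on \<Omega> u)"

end

theory Submission
  imports Defs "HOL-Probability.Distributions"
begin

text \<open>
  By the Gamma integral, \<open>[u]\<^sup>2\<close> is \<open>D/2\<close> times the integral over \<open>t > 0\<close> of \<open>t\<^bsup>s-1\<^esup> E\<^sub>t(u)\<close>, where \<open>E\<^sub>t(u)\<close> is the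
  double integral of \<open>(u(x) - u(y))\<^sup>2\<close> against the Gaussian probability kernel
  \<open>(t/\<pi>)\<^bsup>n/2\<^esup> exp(-t|x-y|\<^sup>2)\<close>, and \<open>D\<close> does not depend on the dimension. Since Gaussian kernels are
  tensor products, this reduces comparisons between dimensions to inequalities for each fixed \<open>t\<close>.

  For the lower bound, positive definiteness of the Gaussian gives \<open>E\<^sub>t(u) \<ge> \<integral> E\<^sub>t(u(x,\<sqdot>)) dx\<close>, so the
  energy on the cylinder dominates the integrated energies of the slices, to which the inequality on
  \<open>\<omega>\<close> applies. For the upper bound,
  \<open>[f \<otimes> g]\<^sup>2 \<le> \<parallel>f\<parallel>\<^sup>2 [g]\<^sup>2 + \<parallel>g\<parallel>\<^sup>2 [f]\<^sup>2\<close>, and the quotient \<open>[f]\<^sup>2 / \<parallel>f\<parallel>\<^sup>2\<close> of a dilated bump function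
  \<open>f(x/R)\<close> decays like \<open>R\<^bsup>-2s\<^esup>\<close>.
\<close>

subsection \<open>The Gaussian kernel\<close>

text \<open>The heat kernel at time \<open>1 / (4 * t)\<close>: a centred Gaussian density with
  variance \<open>1 / (2 * t)\<close> in each coordinate, so large \<open>t\<close> means
  concentration at the origin. The prefactor gives it mass one in every dimension, so integrating
  out one factor of a product leaves no constant behind.\<close>

definition heat :: "real \<Rightarrow> 'a::euclidean_space \<Rightarrow> ennreal" where
  "heat t h = ennreal ((t / pi) powr (real DIM('a) / 2) * exp (- t * (norm h)\<^sup>2))"

lemma borel_measurable_heat [measurable]: "heat t \<in> borel_measurable borel"
  unfolding heat_def by measurable

lemma heat_diff_commute: "heat t (x - y) = heat t (y - x)"
  by (simp add: heat_def norm_minus_commute)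

text \<open>Squared norms add over a product, and so do the exponents of \<open>t / pi\<close>. The
  power kernel of the seminorm does not factor like this, which is why Gaussians replace it.\<close>

lemma heat_Pair:
  fixes a :: "'a::euclidean_space" and b :: "'b::euclidean_space"
  shows "heat t (a, b) = heat t a * heat t b"
proof -
  have "exp (- t * (norm (a, b))\<^sup>2) = exp (- t * (norm a)\<^sup>2) * exp (- t * (norm b)\<^sup>2)"
    by (simp add: norm_Pair mult_exp_exp distrib_left)
  moreover have "(t / pi) powr (real DIM('a \<times> 'b) / 2)
      = (t / pi) powr (real DIM('a) / 2) * (t / pi) powr (real DIM('b) / 2)"
    by (simp add: powr_add[symmetric] add_divide_distrib)
  ultimately show ?thesis
    unfolding heat_def by (subst ennreal_mult[symmetric]) (simp_all only: mult_ac, simp_all)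
qed

lemma heat_prod_Basis:
  fixes h :: "'a::euclidean_space"
  assumes "t > 0"
  shows "heat t h = (\<Prod>b\<in>Basis. ennreal (sqrt (t / pi) * exp (- t * (h \<bullet> b)\<^sup>2)))"
proof -
  have "(t / pi) powr (real DIM('a) / 2) = sqrt (t / pi) ^ DIM('a)"
    using assms by (simp add: powr_half_sqrt[symmetric] powr_powr powr_realpow[symmetric])
  moreover have "(norm h)\<^sup>2 = (\<Sum>b\<in>Basis. (h \<bullet> b)\<^sup>2)"
    unfolding power2_norm_eq_inner by (subst euclidean_inner) (simp add: power2_eq_square)
  ultimately show ?thesis
    using assms
    by (simp add: heat_def prod_ennreal prod.distrib exp_sum[symmetric] sum_distrib_left sum_negf)
qed

lemma nn_integral_heat:
  fixes y :: "'a::euclidean_space"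
  assumes t: "t > 0"
  shows "(\<integral>\<^sup>+x. heat t (x - y) \<partial>lborel) = 1"
proof -
  have *: "(\<integral>\<^sup>+r. ennreal (sqrt (t / pi) * exp (- t * (r - m)\<^sup>2)) \<partial>lborel) = 1" for m
  proof -
    \<comment> \<open>Each one-dimensional factor is the normal density with mean \<open>m\<close>
      and variance \<open>1 / (2 * t)\<close>.\<close>
    have eq: "sqrt (t / pi) * exp (- t * (r - m)\<^sup>2) = normal_density m (1 / sqrt (2 * t)) r" for r
      using t by (simp add: normal_density_def power_divide real_sqrt_divide field_simps)
    show ?thesis
      unfolding eq using t by (subst nn_integral_eq_integral) auto
  qed
  have "(\<integral>\<^sup>+x. heat t (x - y) \<partial>lborel)
      = (\<integral>\<^sup>+x. (\<Prod>b\<in>Basis. ennreal (sqrt (t / pi) * exp (- t * ((x \<bullet> b) - (y \<bullet> b))\<^sup>2))) \<partial>lborel)"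
    using t by (simp add: heat_prod_Basis inner_diff_left)
  also have "\<dots> = (\<Prod>b\<in>Basis. \<integral>\<^sup>+r. ennreal (sqrt (t / pi) * exp (- t * (r - (y \<bullet> b))\<^sup>2)) \<partial>lborel)"
    by (subst nn_integral_lborel_prod) auto
  finally show ?thesis
    by (simp only: * prod.neutral_const)
qed

text \<open>Complete the square around the midpoint \<open>m\<close> of \<open>x\<close> and
  \<open>y\<close>. What depends on \<open>z\<close> is then a Gaussian of parameter
  \<open>4 * t\<close>, which integrates to one.\<close>

lemma heat_semigroup:
  fixes x y :: "'a::euclidean_space"
  assumes t: "t > 0"
  shows "(\<integral>\<^sup>+z. heat (2 * t) (x - z) * heat (2 * t) (z - y) \<partial>lborel) = heat t (x - y)"
proof -
  define m where "m = (1/2::real) *\<^sub>R (x + y)"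
  \<comment> \<open>The parallelogram identity for \<open>x - m\<close>, its negative and
    \<open>z - m\<close>.\<close>
  have n: "2 * t * (norm (x - z))\<^sup>2 + 2 * t * (norm (z - y))\<^sup>2
      = t * (norm (x - y))\<^sup>2 + 4 * t * (norm (z - m))\<^sup>2" for z
    unfolding m_def power2_norm_eq_inner
    by (simp add: inner_diff_left inner_diff_right inner_add_left inner_add_right inner_commute algebra_simps)
  have "(2 * t / pi) * (2 * t / pi) = (t / pi) * (4 * t / pi)"
    by simp
  then have c: "(2 * t / pi) powr p * (2 * t / pi) powr p = (t / pi) powr p * (4 * t / pi) powr p" for p
    using t by (metis powr_mult)
  have "heat (2 * t) (x - z) * heat (2 * t) (z - y) = heat t (x - y) * heat (4 * t) (z - m)" for z
  proof -
    have "heat (2 * t) (x - z) * heat (2 * t) (z - y)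
       = ennreal (((2 * t / pi) powr (real DIM('a) / 2) * (2 * t / pi) powr (real DIM('a) / 2))
          * exp (- (2 * t * (norm (x - z))\<^sup>2 + 2 * t * (norm (z - y))\<^sup>2)))"
      unfolding heat_def by (subst ennreal_mult[symmetric]) (auto simp: mult_exp_exp mult_ac)
    also have "\<dots> = heat t (x - y) * heat (4 * t) (z - m)"
      unfolding heat_def c n
      by (subst ennreal_mult[symmetric]) (auto simp: mult_exp_exp mult_ac)
    finally show ?thesis .
  qed
  then show ?thesis
    using t by (simp add: nn_integral_cmult nn_integral_heat)
qed

section \<open>From the power kernel to Gaussian energies\<close>

text \<open>Two functions are allowed because two different slices of a function on a product have
  to be compared. The expression is not bilinear; for \<open>f = g\<close> it is the Gaussian
  analogue of the double integral in the seminorm.\<close>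

definition heat_energy :: "real \<Rightarrow> ('a::euclidean_space \<Rightarrow> real) \<Rightarrow> ('a \<Rightarrow> real) \<Rightarrow> ennreal" where
  "heat_energy t f g = (\<integral>\<^sup>+y. \<integral>\<^sup>+x. ennreal ((f x - g y)\<^sup>2) * heat t (x - y) \<partial>lborel \<partial>lborel)"

lemma ennreal_sqrt_power2 [simp]: "(ennreal_sqrt x)\<^sup>2 = x"
proof (cases x)
  case (real r)
  then show ?thesis
    by (simp add: ennreal_sqrt_def ennreal_power)
qed (simp add: ennreal_sqrt_def power2_eq_square)

text \<open>Rescaling the variable of the Gamma integral by \<open>r\<^sup>2\<close> exhibits a
  negative power of \<open>r\<close> as a mixture of Gaussians in \<open>r\<close>.\<close>

lemma inverse_powr_conv_nn_integral:
  fixes r p :: real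
  assumes r: "r > 0" and p: "p > 0"
  shows "ennreal (Gamma p / r powr (2 * p))
    = (\<integral>\<^sup>+t\<in>{0<..}. ennreal (t powr (p - 1) * exp (- t * r\<^sup>2)) \<partial>lborel)"
proof -
  have "ennreal (Gamma p) = (\<integral>\<^sup>+t. ennreal (indicator {0..} t * t powr (p - 1) / exp t) \<partial>lborel)"
    by (rule Gamma_conv_nn_integral_real[OF p])
  also have "\<dots> = ennreal (r\<^sup>2) * (\<integral>\<^sup>+t. ennreal (indicator {0..} (r\<^sup>2 * t) * (r\<^sup>2 * t) powr (p - 1) / exp (r\<^sup>2 * t)) \<partial>lborel)"
    using r by (subst nn_integral_real_affine[where c="r\<^sup>2" and t=0]) auto
  also have "\<dots> = (\<integral>\<^sup>+t. ennreal (r\<^sup>2) * ennreal (indicator {0..} (r\<^sup>2 * t) * (r\<^sup>2 * t) powr (p - 1) / exp (r\<^sup>2 * t)) \<partial>lborel)"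
    by (subst nn_integral_cmult) auto
  also have "\<dots> = (\<integral>\<^sup>+t. ennreal (r powr (2 * p)) * (ennreal (t powr (p - 1) * exp (- t * r\<^sup>2)) * indicator {0<..} t) \<partial>lborel)"
  proof (intro nn_integral_cong)
    fix t :: real
    have "r\<^sup>2 * (r\<^sup>2 * t) powr (p - 1) = r powr (2 * p) * t powr (p - 1)" if "t > 0"
    proof -
      have "r\<^sup>2 * (r\<^sup>2 * t) powr (p - 1) = r powr 2 * (r powr 2 * t) powr (p - 1)"
        using r by simp
      also have "\<dots> = r powr (2 + 2 * (p - 1)) * t powr (p - 1)"
        using that r by (simp only: powr_mult powr_powr powr_add mult.assoc)
      finally show ?thesis by simp
    qed
    moreover have "r\<^sup>2 * t \<ge> 0 \<longleftrightarrow> t \<ge> 0" using r by (simp add: zero_le_mult_iff)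
    \<comment> \<open>At \<open>t = 0\<close> the two indicators disagree, but
      \<open>0 powr (p - 1) = 0\<close> makes both sides vanish.\<close>
    ultimately show "ennreal (r\<^sup>2) * ennreal (indicator {0..} (r\<^sup>2 * t) * (r\<^sup>2 * t) powr (p - 1) / exp (r\<^sup>2 * t))
      = ennreal (r powr (2 * p)) * (ennreal (t powr (p - 1) * exp (- t * r\<^sup>2)) * indicator {0<..} t)"
      by (cases "t > 0"; cases "t = 0") (auto simp: ennreal_mult[symmetric] exp_minus indicator_def field_simps)
  qed
  also have "\<dots> = ennreal (r powr (2 * p)) * (\<integral>\<^sup>+t\<in>{0<..}. ennreal (t powr (p - 1) * exp (- t * r\<^sup>2)) \<partial>lborel)"
    by (rule nn_integral_cmult) auto
  finally have "ennreal (Gamma p) / ennreal (r powr (2 * p)) = \<dots> / ennreal (r powr (2 * p))"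
    by simp
  also have "\<dots> = (\<integral>\<^sup>+t\<in>{0<..}. ennreal (t powr (p - 1) * exp (- t * r\<^sup>2)) \<partial>lborel)"
    using r by (subst mult.commute, subst mult_divide_eq_ennreal) (auto)
  finally show ?thesis
    using r p by (simp add: divide_ennreal Gamma_real_pos less_imp_le)
qed

text \<open>What remains of \<open>C_const n s\<close> once \<open>Gamma ((n + 2 * s) / 2)\<close>
  is used up by the Gamma integral and \<open>pi powr (n / 2)\<close> by the normalisation of the
  Gaussian. No dimension is left in it.\<close>

definition D_const :: "real \<Rightarrow> real" where
  "D_const s = s * 2 powr (2 * s) / Gamma (1 - s)"

lemma D_const_pos: "0 < s \<Longrightarrow> s < 1 \<Longrightarrow> D_const s > 0"
  by (simp add: D_const_def Gamma_real_pos)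

text \<open>With \<open>p = (n + 2 * s) / 2\<close>, the factor \<open>t powr (p - 1)\<close> splits
  into the weight \<open>t powr (s - 1)\<close>, the same in all dimensions, and
  \<open>t powr (n / 2)\<close>, which together with the power of \<open>pi\<close> normalises the
  Gaussian.\<close>

lemma heat_t_weight:
  fixes h :: "'a::euclidean_space"
  assumes s: "0 < s" "s < 1" and h: "h \<noteq> 0"
  shows "ennreal (C_const DIM('a) s / 2 * (1 / norm h powr (real DIM('a) + 2 * s)))
   = (\<integral>\<^sup>+t\<in>{0<..}. ennreal (D_const s / 2 * t powr (s - 1)) * heat t h \<partial>lborel)"
proof -
  define n where "n = real DIM('a)"
  define p where "p = (n + 2 * s) / 2"
  have n: "n > 0" by (simp add: n_def)
  have p: "p > 0" using n s by (simp add: p_def)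
  have p2: "n + 2 * s = 2 * p" by (simp add: p_def)
  have Cc: "C_const DIM('a) s = D_const s * Gamma p / pi powr (n / 2)"
    by (simp add: C_const_def D_const_def p_def n_def)
  have "ennreal (C_const DIM('a) s / 2 * (1 / norm h powr (n + 2 * s)))
     = ennreal (D_const s / 2 / pi powr (n / 2)) * ennreal (Gamma p / norm h powr (2 * p))"
    using s p D_const_pos[OF s] by (subst ennreal_mult[symmetric]) (auto simp: Cc p2 Gamma_real_pos less_imp_le)
  also have "\<dots> = (\<integral>\<^sup>+t. ennreal (D_const s / 2 / pi powr (n / 2)) *
      (ennreal (t powr (p - 1) * exp (- t * (norm h)\<^sup>2)) * indicator {0<..} t) \<partial>lborel)"
    using h p by (subst inverse_powr_conv_nn_integral) (auto simp: nn_integral_cmult)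
  also have "\<dots> = (\<integral>\<^sup>+t\<in>{0<..}. ennreal (D_const s / 2 * t powr (s - 1)) * heat t h \<partial>lborel)"
  proof (intro nn_integral_cong)
    fix t :: real
    show "ennreal (D_const s / 2 / pi powr (n / 2)) * (ennreal (t powr (p - 1) * exp (- t * (norm h)\<^sup>2)) * indicator {0<..} t)
       = ennreal (D_const s / 2 * t powr (s - 1)) * heat t h * indicator {0<..} t"
    proof (cases "t > 0")
      case True
      have "t powr (p - 1) = t powr (s - 1) * t powr (n / 2)"
        by (simp add: powr_add[symmetric] p_def add_divide_distrib algebra_simps)
      moreover have "(t / pi) powr (n / 2) = t powr (n / 2) / pi powr (n / 2)"
        using True by (simp add: powr_divide)
      ultimately show ?thesis
        using True D_const_pos[OF s]
        by (simp add: heat_def n_def[symmetric] ennreal_mult[symmetric])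
    qed simp
  qed
  finally show ?thesis by (simp add: n_def)
qed

text \<open>Insert the Gaussian mixture into the double integral and move the integral over
  \<open>t\<close> outside by Tonelli. Inequalities between energies at fixed \<open>t\<close> can
  then be integrated against one weight, whatever the dimensions involved.\<close>

lemma gagliardo_eq_heat_energy:
  fixes u :: "'a::euclidean_space \<Rightarrow> real"
  assumes s: "0 < s" "s < 1" and [measurable]: "u \<in> borel_measurable borel"
  shows "(gagliardo_seminorm s u)\<^sup>2
    = (\<integral>\<^sup>+t\<in>{0<..}. ennreal (D_const s / 2 * t powr (s - 1)) * heat_energy t u u \<partial>lborel)"
proof -
  define n where "n = real DIM('a)"
  define w where "w = (\<lambda>t. ennreal (D_const s / 2 * t powr (s - 1)) * indicator {0<..} t)"
  have [measurable]: "w \<in> borel_measurable borel" by (auto simp: w_def)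
  have [measurable]: "(\<lambda>x. heat (f x) (g x :: 'a)) \<in> borel_measurable M"
    if [measurable]: "f \<in> borel_measurable M" "g \<in> borel_measurable M" for f g and M :: "'c measure"
    unfolding heat_def by measurable
  have C: "C_const DIM('a) s > 0"
    using s by (simp add: C_const_def Gamma_real_pos)
  have *: "ennreal (C_const DIM('a) s / 2) * ennreal (\<bar>u x - u y\<bar>\<^sup>2 / norm (x - y) powr (real DIM('a) + 2 * s))
     = (\<integral>\<^sup>+t. w t * (ennreal ((u x - u y)\<^sup>2) * heat t (x - y)) \<partial>lborel)" for x y
  \<comment> \<open>On the diagonal both sides vanish with \<open>u x - u y\<close>, so
    \<open>heat_t_weight\<close> is only called for \<open>h \<noteq> 0\<close>.\<close>
  proof (cases "x = y")
    case False
    have "ennreal (C_const DIM('a) s / 2) * ennreal (\<bar>u x - u y\<bar>\<^sup>2 / norm (x - y) powr (real DIM('a) + 2 * s))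
      = ennreal ((u x - u y)\<^sup>2) * ennreal (C_const DIM('a) s / 2 * (1 / norm (x - y) powr (real DIM('a) + 2 * s)))"
      using C by (simp add: ennreal_mult[symmetric] mult_ac)
    also have "\<dots> = (\<integral>\<^sup>+t. ennreal ((u x - u y)\<^sup>2) * (ennreal (D_const s / 2 * t powr (s - 1)) * heat t (x - y) * indicator {0<..} t) \<partial>lborel)"
      using False by (subst heat_t_weight[OF s]) (auto simp: nn_integral_cmult)
    finally show ?thesis
      by (simp add: w_def mult_ac)
  qed simp
  have "(gagliardo_seminorm s u)\<^sup>2 = (\<integral>\<^sup>+y. \<integral>\<^sup>+x. (\<integral>\<^sup>+t. w t * (ennreal ((u x - u y)\<^sup>2) * heat t (x - y)) \<partial>lborel) \<partial>lborel \<partial>lborel)"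
    unfolding gagliardo_seminorm_def ennreal_sqrt_power2 *[symmetric]
    by (simp add: nn_integral_cmult)
  also have "\<dots> = (\<integral>\<^sup>+y. \<integral>\<^sup>+t. (\<integral>\<^sup>+x. w t * (ennreal ((u x - u y)\<^sup>2) * heat t (x - y)) \<partial>lborel) \<partial>lborel \<partial>lborel)"
    by (intro nn_integral_cong lborel_pair.Fubini') measurable
  also have "\<dots> = (\<integral>\<^sup>+t. \<integral>\<^sup>+y. (\<integral>\<^sup>+x. w t * (ennreal ((u x - u y)\<^sup>2) * heat t (x - y)) \<partial>lborel) \<partial>lborel \<partial>lborel)"
    by (intro lborel_pair.Fubini') measurable
  also have "\<dots> = (\<integral>\<^sup>+t. w t * heat_energy t u u \<partial>lborel)"
    unfolding heat_energy_def by (simp add: nn_integral_cmult)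
  finally show ?thesis by (simp add: w_def mult_ac)
qed

subsection \<open>Energies on products\<close>

lemma borel_measurable_heat_comp [measurable (raw)]:
  assumes [measurable]: "f \<in> borel_measurable M" "g \<in> borel_measurable M"
  shows "(\<lambda>x. heat (f x) (g x :: 'a::euclidean_space)) \<in> borel_measurable M"
  unfolding heat_def by measurable

text \<open>A general integrand \<open>F\<close> makes linearity and symmetry available for cross
  terms. On a product, \<open>F\<close> will itself be an energy of two slices.\<close>

definition heat_mean :: "real \<Rightarrow> ('a::euclidean_space \<Rightarrow> 'a \<Rightarrow> ennreal) \<Rightarrow> ennreal" where
  "heat_mean t F = (\<integral>\<^sup>+y. \<integral>\<^sup>+x. F x y * heat t (x - y) \<partial>lborel \<partial>lborel)"

lemma heat_energy_eq_mean: "heat_energy t f g = heat_mean t (\<lambda>x y. ennreal ((f x - g y)\<^sup>2))"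
  by (simp add: heat_energy_def heat_mean_def)

lemma heat_mean_mono: "(\<And>x y. F x y \<le> G x y) \<Longrightarrow> heat_mean t F \<le> heat_mean t G"
  unfolding heat_mean_def by (intro nn_integral_mono mult_right_mono) auto

lemma heat_mean_add:
  fixes F G :: "'a::euclidean_space \<Rightarrow> 'a \<Rightarrow> ennreal"
  assumes [measurable]: "case_prod F \<in> borel_measurable (borel \<Otimes>\<^sub>M borel)" "case_prod G \<in> borel_measurable (borel \<Otimes>\<^sub>M borel)"
  shows "heat_mean t (\<lambda>x y. F x y + G x y) = heat_mean t F + heat_mean t G"
  unfolding heat_mean_def by (simp add: distrib_right nn_integral_add)

lemma heat_mean_cmult:
  fixes F :: "'a::euclidean_space \<Rightarrow> 'a \<Rightarrow> ennreal"
  assumes [measurable]: "case_prod F \<in> borel_measurable (borel \<Otimes>\<^sub>M borel)"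
  shows "heat_mean t (\<lambda>x y. c * F x y) = c * heat_mean t F"
  unfolding heat_mean_def by (simp add: mult.assoc nn_integral_cmult)

lemma heat_mean_swap:
  fixes F :: "'a::euclidean_space \<Rightarrow> 'a \<Rightarrow> ennreal"
  assumes [measurable]: "case_prod F \<in> borel_measurable (borel \<Otimes>\<^sub>M borel)"
  shows "heat_mean t (\<lambda>x y. F y x) = heat_mean t F"
  unfolding heat_mean_def
  by (subst lborel_pair.Fubini') (simp_all add: heat_diff_commute)

lemma heat_mean_snd:
  fixes F :: "'a::euclidean_space \<Rightarrow> ennreal"
  assumes "t > 0" and [measurable]: "F \<in> borel_measurable borel"
  shows "heat_mean t (\<lambda>x y. F y) = (\<integral>\<^sup>+x. F x \<partial>lborel)"
  unfolding heat_mean_def using assms(1) by (simp add: nn_integral_cmult nn_integral_heat)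

lemma heat_mean_fst:
  fixes F :: "'a::euclidean_space \<Rightarrow> ennreal"
  assumes "t > 0" and [measurable]: "F \<in> borel_measurable borel"
  shows "heat_mean t (\<lambda>x y. F x) = (\<integral>\<^sup>+x. F x \<partial>lborel)"
  using heat_mean_snd[OF assms] by (subst heat_mean_swap) simp_all

lemma heat_energy_commute:
  fixes f g :: "'a::euclidean_space \<Rightarrow> real"
  assumes [measurable]: "f \<in> borel_measurable borel" "g \<in> borel_measurable borel"
  shows "heat_energy t g f = heat_energy t f g"
  unfolding heat_energy_eq_mean
  by (subst heat_mean_swap[symmetric]) (simp_all add: power2_commute)

section \<open>Positive definiteness and polarization\<close>

text \<open>Routing the kernel through an intermediate point \<open>z\<close> by the semigroup
  property decouples \<open>x\<close> from \<open>y\<close>: the result is the inner product of the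
  smoothings of \<open>A\<close> and \<open>B\<close> at parameter \<open>2 * t\<close>.\<close>

lemma heat_mean_product:
  fixes A B :: "'a::euclidean_space \<Rightarrow> ennreal"
  assumes t: "t > 0" and [measurable]: "A \<in> borel_measurable borel" "B \<in> borel_measurable borel"
  shows "heat_mean t (\<lambda>x y. A x * B y)
    = (\<integral>\<^sup>+z. (\<integral>\<^sup>+x. A x * heat (2 * t) (x - z) \<partial>lborel) * (\<integral>\<^sup>+y. B y * heat (2 * t) (y - z) \<partial>lborel) \<partial>lborel)"
proof -
  have "heat_mean t (\<lambda>x y. A x * B y)
    = (\<integral>\<^sup>+y. \<integral>\<^sup>+x. \<integral>\<^sup>+z. (A x * heat (2 * t) (x - z)) * (B y * heat (2 * t) (y - z)) \<partial>lborel \<partial>lborel \<partial>lborel)"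
    unfolding heat_mean_def heat_semigroup[OF t, symmetric]
    by (simp add: nn_integral_cmult[symmetric] mult_ac heat_diff_commute cong: nn_integral_cong)
  also have "\<dots> = (\<integral>\<^sup>+y. \<integral>\<^sup>+z. \<integral>\<^sup>+x. (A x * heat (2 * t) (x - z)) * (B y * heat (2 * t) (y - z)) \<partial>lborel \<partial>lborel \<partial>lborel)"
    by (intro nn_integral_cong lborel_pair.Fubini') measurable
  also have "\<dots> = (\<integral>\<^sup>+z. \<integral>\<^sup>+y. \<integral>\<^sup>+x. (A x * heat (2 * t) (x - z)) * (B y * heat (2 * t) (y - z)) \<partial>lborel \<partial>lborel \<partial>lborel)"
    by (intro lborel_pair.Fubini') measurable
  finally show ?thesis
    by (simp add: nn_integral_cmult nn_integral_multc)
qed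

lemma ennreal_sum_squares_bound: "2 * (a * b) \<le> a * a + b * (b::ennreal)"
proof (cases "a = top \<or> b = top")
  case False
  then obtain x y where "a = ennreal x" "b = ennreal y" "x \<ge> 0" "y \<ge> 0"
    by (metis ennreal_cases)
  moreover have "2 * (x * y) \<le> x * x + y * y"
    using sum_squares_bound[of x y] by (simp add: power2_eq_square)
  ultimately have "ennreal (2 * (x * y)) \<le> ennreal (x * x + y * y)"
    by (intro ennreal_leI)
  then show ?thesis
    using \<open>a = _\<close> \<open>b = _\<close> \<open>x \<ge> 0\<close> \<open>y \<ge> 0\<close> by (simp add: ennreal_mult)
qed auto

text \<open>By the semigroup property the heat kernel is positive definite.\<close>

lemma heat_mean_positive_definite:
  fixes A B :: "'a::euclidean_space \<Rightarrow> ennreal"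
  assumes t: "t > 0" and [measurable]: "A \<in> borel_measurable borel" "B \<in> borel_measurable borel"
  shows "2 * heat_mean t (\<lambda>x y. A x * B y) \<le> heat_mean t (\<lambda>x y. A x * A y) + heat_mean t (\<lambda>x y. B x * B y)"
  unfolding heat_mean_product[OF t assms(2,3)] heat_mean_product[OF t assms(2,2)] heat_mean_product[OF t assms(3,3)]
  by (subst nn_integral_cmult[symmetric], measurable, subst nn_integral_add[symmetric])
     (auto intro!: nn_integral_mono ennreal_sum_squares_bound)

lemma L2_diff_finite:
  fixes f g :: "'a::euclidean_space \<Rightarrow> real"
  assumes [measurable]: "f \<in> borel_measurable borel" "g \<in> borel_measurable borel"
    and "(\<integral>\<^sup>+x. ennreal ((f x)\<^sup>2) \<partial>lborel) < top" "(\<integral>\<^sup>+x. ennreal ((g x)\<^sup>2) \<partial>lborel) < top"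
  shows "(\<integral>\<^sup>+x. ennreal ((f x - g x)\<^sup>2) \<partial>lborel) < top"
proof -
  have "(\<integral>\<^sup>+x. ennreal ((f x - g x)\<^sup>2) \<partial>lborel) \<le> (\<integral>\<^sup>+x. 2 * ennreal ((f x)\<^sup>2) + 2 * ennreal ((g x)\<^sup>2) \<partial>lborel)"
  proof (intro nn_integral_mono)
    fix x
    have "(f x - g x)\<^sup>2 \<le> 2 * (f x)\<^sup>2 + 2 * (g x)\<^sup>2"
      using zero_le_power2[of "f x + g x"] by (simp add: power2_eq_square algebra_simps)
    then have "ennreal ((f x - g x)\<^sup>2) \<le> ennreal (2 * (f x)\<^sup>2 + 2 * (g x)\<^sup>2)"
      by (rule ennreal_leI)
    then show "ennreal ((f x - g x)\<^sup>2) \<le> 2 * ennreal ((f x)\<^sup>2) + 2 * ennreal ((g x)\<^sup>2)"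
      by (simp add: ennreal_mult)
  qed
  also have "\<dots> < top"
    using assms(3,4) by (simp add: nn_integral_add nn_integral_cmult ennreal_mult_less_top)
  finally show ?thesis .
qed

text \<open>Pointwise, the two mixed squares minus the two pure ones equal
  \<open>2 * w x * w y\<close> with \<open>w = f - g\<close>, and the Gaussian mean of this is
  nonnegative by positive definiteness. As the integrals live in \<open>ennreal\<close>,
  \<open>w\<close> is split into its positive part \<open>P\<close> and negative part
  \<open>N\<close>, and each negative term is moved to the other side.\<close>

lemma heat_energy_polarization:
  fixes f g :: "'a::euclidean_space \<Rightarrow> real"
  assumes t: "t > 0" and [measurable]: "f \<in> borel_measurable borel" "g \<in> borel_measurable borel"
    and fin: "(\<integral>\<^sup>+x. ennreal ((f x)\<^sup>2) \<partial>lborel) < top" "(\<integral>\<^sup>+x. ennreal ((g x)\<^sup>2) \<partial>lborel) < top"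
  shows "heat_energy t f f + heat_energy t g g \<le> 2 * heat_energy t f g"
proof -
  define w where "w x = f x - g x" for x
  define P where "P x = ennreal (max 0 (w x))" for x
  define N where "N x = ennreal (max 0 (- w x))" for x
  have [measurable]: "w \<in> borel_measurable borel" unfolding w_def by measurable
  have [measurable]: "P \<in> borel_measurable borel" "N \<in> borel_measurable borel"
    unfolding P_def N_def by measurable
  define X where "X = heat_mean t (\<lambda>x y. P x * N y)"
  define Y where "Y = heat_mean t (\<lambda>x y. P x * P y) + heat_mean t (\<lambda>x y. N x * N y)"
  have X': "heat_mean t (\<lambda>x y. N x * P y) = X"
    unfolding X_def by (subst heat_mean_swap[symmetric]) (simp_all add: mult.commute)
  have XY: "2 * X \<le> Y"
    unfolding X_def Y_def by (rule heat_mean_positive_definite[OF t]) simp_all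
  have pt: "ennreal ((f x - g y)\<^sup>2) + (ennreal ((g x - f y)\<^sup>2) + 2 * (P x * N y + N x * P y))
     = ennreal ((f x - f y)\<^sup>2) + (ennreal ((g x - g y)\<^sup>2) + 2 * (P x * P y + N x * N y))" for x y
  proof -
    have *: "(f x - g y)\<^sup>2 + ((g x - f y)\<^sup>2 + 2 * (max 0 (w x) * max 0 (- w y) + max 0 (- w x) * max 0 (w y)))
     = (f x - f y)\<^sup>2 + ((g x - g y)\<^sup>2 + 2 * (max 0 (w x) * max 0 (w y) + max 0 (- w x) * max 0 (- w y)))"
      unfolding w_def by (auto simp: max_def power2_eq_square algebra_simps)
    have "ennreal ((f x - g y)\<^sup>2) + (ennreal ((g x - f y)\<^sup>2) + 2 * (P x * N y + N x * P y))
      = ennreal ((f x - g y)\<^sup>2 + ((g x - f y)\<^sup>2 + 2 * (max 0 (w x) * max 0 (- w y) + max 0 (- w x) * max 0 (w y))))"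
      unfolding P_def N_def by (simp add: ennreal_mult)
    also have "\<dots> = ennreal ((f x - f y)\<^sup>2) + (ennreal ((g x - g y)\<^sup>2) + 2 * (P x * P y + N x * N y))"
      unfolding * P_def N_def by (simp add: ennreal_mult)
    finally show ?thesis .
  qed
  have "heat_energy t f g + (heat_energy t g f + 2 * (X + heat_mean t (\<lambda>x y. N x * P y)))
    = heat_mean t (\<lambda>x y. ennreal ((f x - g y)\<^sup>2) + (ennreal ((g x - f y)\<^sup>2) + 2 * (P x * N y + N x * P y)))"
    unfolding heat_energy_eq_mean X_def by (simp add: heat_mean_add heat_mean_cmult)
  also have "\<dots> = heat_energy t f f + (heat_energy t g g + 2 * Y)"
    unfolding pt heat_energy_eq_mean Y_def by (simp add: heat_mean_add heat_mean_cmult)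
  finally have "2 * heat_energy t f g + 2 * (X + X) = (heat_energy t f f + heat_energy t g g) + 2 * Y"
    unfolding X' by (simp add: heat_energy_commute mult_2[of "heat_energy t f g"] ac_simps)
  moreover have "2 * (X + X) \<le> 2 * Y"
    using XY by (intro mult_left_mono) (simp_all add: mult_2)
  ultimately have "2 * (X + X) + (heat_energy t f f + heat_energy t g g) \<le> 2 * (X + X) + 2 * heat_energy t f g"
    by (metis add.commute add_left_mono)
  \<comment> \<open>Cancelling \<open>2 * (X + X)\<close> in \<open>ennreal\<close> is only
    legitimate if it is finite; this is where square integrability of \<open>f\<close> and
    \<open>g\<close> enters.\<close>
  moreover have "X < top"
  proof -
    have "X \<le> heat_mean t (\<lambda>x y. ennreal ((w x)\<^sup>2) + ennreal ((w y)\<^sup>2))"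
      unfolding X_def
    proof (rule heat_mean_mono)
      fix x y
      have "max 0 (w x) * max 0 (- w y) \<le> (w x)\<^sup>2 + (w y)\<^sup>2"
      proof -
        have "- (w x * w y) \<le> (w x)\<^sup>2 + (w y)\<^sup>2"
          using zero_le_power2[of "w x + w y"] zero_le_power2[of "w x"] zero_le_power2[of "w y"]
          unfolding power2_sum by linarith
        then show ?thesis
          by (auto simp: max_def)
      qed
      then show "P x * N y \<le> ennreal ((w x)\<^sup>2) + ennreal ((w y)\<^sup>2)"
        unfolding P_def N_def by (simp add: ennreal_mult[symmetric] ennreal_plus[symmetric] del: ennreal_plus)
    qed
    also have "\<dots> = 2 * (\<integral>\<^sup>+x. ennreal ((w x)\<^sup>2) \<partial>lborel)"
      using t by (simp add: heat_mean_add heat_mean_fst heat_mean_snd mult_2)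
    also have "\<dots> < top"
      unfolding w_def using L2_diff_finite[OF _ _ fin] by (simp add: ennreal_mult_less_top)
    finally show ?thesis .
  qed
  ultimately show ?thesis
    by (subst (asm) ennreal_add_left_cancel_le) (auto simp: ennreal_mult_eq_top_iff)
qed

section \<open>Slices and tensor products at fixed \<open>t\<close>\<close>

lemma nn_integral_lborel_Pair:
  fixes f :: "'a::euclidean_space \<times> 'b::euclidean_space \<Rightarrow> ennreal"
  assumes [measurable]: "f \<in> borel_measurable borel"
  shows "(\<integral>\<^sup>+p. f p \<partial>lborel) = (\<integral>\<^sup>+x. \<integral>\<^sup>+y. f (x, y) \<partial>lborel \<partial>lborel)"
proof -
  have "f \<in> borel_measurable (lborel \<Otimes>\<^sub>M lborel)"
    by (simp add: lborel_prod)
  from lborel.nn_integral_fst[OF this] show ?thesis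
    by (simp add: lborel_prod)
qed

text \<open>By \<open>heat_Pair\<close> the kernel on the product splits, and Tonelli groups the two
  variables of the first factor and the two of the second.\<close>

lemma heat_energy_Pair:
  fixes u v :: "'a::euclidean_space \<times> 'b::euclidean_space \<Rightarrow> real"
  assumes "u \<in> borel_measurable borel" "v \<in> borel_measurable borel"
  shows "heat_energy t u v = heat_mean t (\<lambda>x x'. heat_energy t (\<lambda>y. u (x, y)) (\<lambda>y. v (x', y)))"
proof -
  have [measurable]: "u \<in> borel_measurable (borel \<Otimes>\<^sub>M borel)" "v \<in> borel_measurable (borel \<Otimes>\<^sub>M borel)"
    using assms by (simp_all add: borel_prod)
  note assms[measurable]
  have "heat_energy t u v = (\<integral>\<^sup>+x'. \<integral>\<^sup>+y'. (\<integral>\<^sup>+x. \<integral>\<^sup>+y. ennreal ((u (x, y) - v (x', y'))\<^sup>2) * heat t ((x, y) - (x', y')) \<partial>lborel \<partial>lborel) \<partial>lborel \<partial>lborel)"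
    unfolding heat_energy_def
    by (subst nn_integral_lborel_Pair, measurable, subst nn_integral_lborel_Pair) simp_all
  also have "\<dots> = (\<integral>\<^sup>+x'. \<integral>\<^sup>+y'. (\<integral>\<^sup>+x. \<integral>\<^sup>+y. (ennreal ((u (x, y) - v (x', y'))\<^sup>2) * heat t (y - y')) * heat t (x - x') \<partial>lborel \<partial>lborel) \<partial>lborel \<partial>lborel)"
    by (simp add: heat_Pair mult_ac)
  also have "\<dots> = (\<integral>\<^sup>+x'. \<integral>\<^sup>+x. (\<integral>\<^sup>+y'. \<integral>\<^sup>+y. (ennreal ((u (x, y) - v (x', y'))\<^sup>2) * heat t (y - y')) * heat t (x - x') \<partial>lborel \<partial>lborel) \<partial>lborel \<partial>lborel)"
    by (intro nn_integral_cong lborel_pair.Fubini') measurable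
  finally show ?thesis
    unfolding heat_mean_def heat_energy_def by (simp add: nn_integral_multc)
qed

text \<open>Polarization bounds the mixed energy of the slices at \<open>x\<close> and
  \<open>x'\<close> below by the average of their own energies. By unit mass, the Gaussian mean of
  this average is the integral of the slice energies.\<close>

lemma heat_energy_slices_le:
  fixes u :: "'a::euclidean_space \<times> 'b::euclidean_space \<Rightarrow> real"
  assumes t: "t > 0" and u: "u \<in> borel_measurable borel"
    and fin: "\<And>x. (\<integral>\<^sup>+y. ennreal ((u (x, y))\<^sup>2) \<partial>lborel) < top"
  shows "(\<integral>\<^sup>+x. heat_energy t (\<lambda>y. u (x, y)) (\<lambda>y. u (x, y)) \<partial>lborel) \<le> heat_energy t u u"
proof -
  have [measurable]: "u \<in> borel_measurable (borel \<Otimes>\<^sub>M borel)"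
    using u by (simp add: borel_prod)
  define e where "e x = heat_energy t (\<lambda>y. u (x, y)) (\<lambda>y. u (x, y))" for x
  have [measurable]: "e \<in> borel_measurable borel"
    unfolding e_def heat_energy_def by measurable
  have "2 * (\<integral>\<^sup>+x. e x \<partial>lborel) = heat_mean t (\<lambda>x x'. e x + e x')"
    using t by (simp add: heat_mean_add heat_mean_fst heat_mean_snd mult_2)
  also have "\<dots> \<le> heat_mean t (\<lambda>x x'. 2 * heat_energy t (\<lambda>y. u (x, y)) (\<lambda>y. u (x', y)))"
    unfolding e_def by (intro heat_mean_mono heat_energy_polarization t fin) measurable
  also have "\<dots> = 2 * heat_energy t u u"
    unfolding heat_energy_Pair[OF u u]
    by (rule heat_mean_cmult) (unfold heat_energy_def, measurable)
  finally show ?thesis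
    unfolding e_def by (subst (asm) ennreal_mult_le_mult_iff) auto
qed

text \<open>Symmetrise in \<open>x\<close> and \<open>x'\<close>, then apply the pointwise
  inequality \<open>pt\<close> with \<open>a = f x\<close>, \<open>b = f x'\<close>,
  \<open>c = g y\<close>, \<open>d = g y'\<close>. The only loss in it is
  \<open>2 * c * d \<le> c\<^sup>2 + d\<^sup>2\<close>. Unit mass integrates out whichever variable
  a square does not contain.\<close>

lemma heat_energy_tensor_le:
  fixes f :: "'a::euclidean_space \<Rightarrow> real" and g :: "'b::euclidean_space \<Rightarrow> real"
  assumes t: "t > 0" and [measurable]: "f \<in> borel_measurable borel" "g \<in> borel_measurable borel"
  shows "heat_energy t (\<lambda>(x, y). f x * g y) (\<lambda>(x, y). f x * g y)
    \<le> (\<integral>\<^sup>+x. ennreal ((f x)\<^sup>2) \<partial>lborel) * heat_energy t g g + (\<integral>\<^sup>+x. ennreal ((g x)\<^sup>2) \<partial>lborel) * heat_energy t f f"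
    (is "?E \<le> ?F * _ + ?G * _")
proof -
  have pt: "ennreal ((a * c - b * d)\<^sup>2) + ennreal ((b * c - a * d)\<^sup>2)
    \<le> (ennreal (a\<^sup>2) + ennreal (b\<^sup>2)) * ennreal ((c - d)\<^sup>2) + ennreal ((a - b)\<^sup>2) * (ennreal (c\<^sup>2) + ennreal (d\<^sup>2))" for a b c d :: real
  proof -
    have "(a * c - b * d)\<^sup>2 + (b * c - a * d)\<^sup>2
      = (a\<^sup>2 + b\<^sup>2) * (c - d)\<^sup>2 + (a - b)\<^sup>2 * (2 * c * d)"
      by (simp add: power2_eq_square algebra_simps)
    also have "\<dots> \<le> (a\<^sup>2 + b\<^sup>2) * (c - d)\<^sup>2 + (a - b)\<^sup>2 * (c\<^sup>2 + d\<^sup>2)"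
      by (intro add_left_mono mult_left_mono) (auto simp: sum_squares_bound)
    finally show ?thesis
      by (subst ennreal_plus[symmetric], simp, simp, subst ennreal_plus[symmetric], simp, simp,
          subst ennreal_plus[symmetric], simp, simp, subst ennreal_mult[symmetric], simp, simp,
          subst ennreal_mult[symmetric], simp, simp, subst ennreal_plus[symmetric], simp, simp,
          rule ennreal_leI)
  qed
  define J where "J x x' = heat_energy t (\<lambda>y. f x * g y) (\<lambda>y. f x' * g y)" for x x'
  have [measurable]: "case_prod J \<in> borel_measurable (borel \<Otimes>\<^sub>M borel)"
    unfolding J_def heat_energy_def by measurable
  have "(\<lambda>(x, y). f x * g y) \<in> borel_measurable (borel \<Otimes>\<^sub>M borel)"
    by measurable
  then have E: "?E = heat_mean t J"
    unfolding J_def by (subst heat_energy_Pair) (simp_all add: borel_prod)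
  \<comment> \<open>The factor 2 comes from the symmetrisation and is divided out at the
    end.\<close>
  have "2 * ?E = heat_mean t (\<lambda>x x'. J x x' + J x' x)"
    by (simp add: heat_mean_add heat_mean_swap[of J] E mult_2)
  also have "\<dots> \<le> heat_mean t (\<lambda>x x'. heat_energy t g g * (ennreal ((f x)\<^sup>2) + ennreal ((f x')\<^sup>2)) + (2 * ?G) * ennreal ((f x - f x')\<^sup>2))"
  proof (rule heat_mean_mono)
    fix x x'
    have "J x x' + J x' x = heat_mean t (\<lambda>y y'. ennreal ((f x * g y - f x' * g y')\<^sup>2) + ennreal ((f x' * g y - f x * g y')\<^sup>2))"
      unfolding J_def heat_energy_eq_mean by (subst heat_mean_add) simp_all
    also have "\<dots> \<le> heat_mean t (\<lambda>y y'. (ennreal ((f x)\<^sup>2) + ennreal ((f x')\<^sup>2)) * ennreal ((g y - g y')\<^sup>2)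
        + ennreal ((f x - f x')\<^sup>2) * (ennreal ((g y)\<^sup>2) + ennreal ((g y')\<^sup>2)))"
      by (intro heat_mean_mono pt)
    also have "\<dots> = (ennreal ((f x)\<^sup>2) + ennreal ((f x')\<^sup>2)) * heat_energy t g g + ennreal ((f x - f x')\<^sup>2) * (2 * ?G)"
      unfolding heat_energy_eq_mean using t
      by (simp add: heat_mean_add heat_mean_cmult heat_mean_fst heat_mean_snd mult_2)
    finally show "J x x' + J x' x \<le> heat_energy t g g * (ennreal ((f x)\<^sup>2) + ennreal ((f x')\<^sup>2)) + (2 * ?G) * ennreal ((f x - f x')\<^sup>2)"
      by (simp add: mult_ac)
  qed
  also have "\<dots> = 2 * (?F * heat_energy t g g + ?G * heat_energy t f f)"
    using t by (simp add: heat_mean_add heat_mean_cmult heat_mean_fst heat_mean_snd heat_energy_eq_mean[of t f f])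
       (simp add: mult_2 mult_2_right algebra_simps)
  finally show ?thesis
    by (subst (asm) ennreal_mult_le_mult_iff) auto
qed

section \<open>From fixed \<open>t\<close> to the seminorm\<close>

text \<open>Integrate \<open>heat_energy_slices_le\<close> over \<open>t\<close>. The same weight
  represents the seminorm on the slices and on the product because \<open>D_const\<close> is free of
  the dimension.\<close>

lemma gagliardo_slices_le:
  fixes u :: "'a::euclidean_space \<times> 'b::euclidean_space \<Rightarrow> real"
  assumes s: "0 < s" "s < 1" and u: "u \<in> borel_measurable borel"
    and fin: "\<And>x. (\<integral>\<^sup>+y. ennreal ((u (x, y))\<^sup>2) \<partial>lborel) < top"
  shows "(\<integral>\<^sup>+x. (gagliardo_seminorm s (\<lambda>y. u (x, y)))\<^sup>2 \<partial>lborel) \<le> (gagliardo_seminorm s u)\<^sup>2"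
proof -
  have [measurable]: "u \<in> borel_measurable (borel \<Otimes>\<^sub>M borel)"
    using u by (simp add: borel_prod)
  define w where "w = (\<lambda>t. ennreal (D_const s / 2 * t powr (s - 1)) * indicator {0<..} t)"
  have [measurable]: "w \<in> borel_measurable borel" by (auto simp: w_def)
  have "(\<integral>\<^sup>+x. (gagliardo_seminorm s (\<lambda>y. u (x, y)))\<^sup>2 \<partial>lborel)
     = (\<integral>\<^sup>+x. \<integral>\<^sup>+t. w t * heat_energy t (\<lambda>y. u (x, y)) (\<lambda>y. u (x, y)) \<partial>lborel \<partial>lborel)"
    by (subst gagliardo_eq_heat_energy[OF s]) (simp_all add: w_def mult_ac)
  also have "\<dots> = (\<integral>\<^sup>+t. \<integral>\<^sup>+x. w t * heat_energy t (\<lambda>y. u (x, y)) (\<lambda>y. u (x, y)) \<partial>lborel \<partial>lborel)"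
    unfolding heat_energy_def by (intro lborel_pair.Fubini') measurable
  also have "\<dots> = (\<integral>\<^sup>+t. w t * (\<integral>\<^sup>+x. heat_energy t (\<lambda>y. u (x, y)) (\<lambda>y. u (x, y)) \<partial>lborel) \<partial>lborel)"
    unfolding heat_energy_def by (simp add: nn_integral_cmult)
  also have "\<dots> \<le> (\<integral>\<^sup>+t. w t * heat_energy t u u \<partial>lborel)"
    by (intro nn_integral_mono)
       (auto simp: w_def indicator_def intro!: mult_left_mono heat_energy_slices_le u fin)
  also have "\<dots> = (gagliardo_seminorm s u)\<^sup>2"
    using u by (subst gagliardo_eq_heat_energy[OF s]) (simp_all add: w_def mult_ac)
  finally show ?thesis .
qed

lemma gagliardo_tensor_le:
  fixes f :: "'a::euclidean_space \<Rightarrow> real" and g :: "'b::euclidean_space \<Rightarrow> real"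
  assumes s: "0 < s" "s < 1" and [measurable]: "f \<in> borel_measurable borel" "g \<in> borel_measurable borel"
  shows "(gagliardo_seminorm s (\<lambda>(x, y). f x * g y))\<^sup>2
    \<le> (\<integral>\<^sup>+x. ennreal ((f x)\<^sup>2) \<partial>lborel) * (gagliardo_seminorm s g)\<^sup>2
      + (\<integral>\<^sup>+x. ennreal ((g x)\<^sup>2) \<partial>lborel) * (gagliardo_seminorm s f)\<^sup>2"
    (is "_ \<le> ?F * _ + ?G * _")
proof -
  define w where "w = (\<lambda>t. ennreal (D_const s / 2 * t powr (s - 1)) * indicator {0<..} t)"
  have [measurable]: "w \<in> borel_measurable borel" by (auto simp: w_def)
  \<comment> \<open>Polymorphic in \<open>'c\<close>, so that one weight \<open>w\<close> serves
    \<open>f\<close>, \<open>g\<close> and their tensor product.\<close>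
  have eq: "(gagliardo_seminorm s u)\<^sup>2 = (\<integral>\<^sup>+t. w t * heat_energy t u u \<partial>lborel)"
    if "u \<in> borel_measurable borel" for u :: "'c::euclidean_space \<Rightarrow> real"
    using that by (subst gagliardo_eq_heat_energy[OF s]) (simp_all add: w_def mult_ac)
  have "(\<lambda>(x, y). f x * g y) \<in> borel_measurable (borel \<Otimes>\<^sub>M borel)"
    by measurable
  then have "(gagliardo_seminorm s (\<lambda>(x, y). f x * g y))\<^sup>2
      = (\<integral>\<^sup>+t. w t * heat_energy t (\<lambda>(x, y). f x * g y) (\<lambda>(x, y). f x * g y) \<partial>lborel)"
    by (intro eq) (simp add: borel_prod)
  also have "\<dots> \<le> (\<integral>\<^sup>+t. ?F * (w t * heat_energy t g g) + ?G * (w t * heat_energy t f f) \<partial>lborel)"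
  proof (intro nn_integral_mono)
    fix t
    show "w t * heat_energy t (\<lambda>(x, y). f x * g y) (\<lambda>(x, y). f x * g y)
      \<le> ?F * (w t * heat_energy t g g) + ?G * (w t * heat_energy t f f)"
    proof (cases "t > 0")
      case True
      have "w t * heat_energy t (\<lambda>(x, y). f x * g y) (\<lambda>(x, y). f x * g y)
        \<le> w t * (?F * heat_energy t g g + ?G * heat_energy t f f)"
        using True by (intro mult_left_mono heat_energy_tensor_le) auto
      then show ?thesis
        by (simp add: algebra_simps)
    qed (simp add: w_def)
  qed
  also have "\<dots> = ?F * (gagliardo_seminorm s g)\<^sup>2 + ?G * (gagliardo_seminorm s f)\<^sup>2"
    by (simp add: eq nn_integral_add nn_integral_cmult heat_energy_def)
  finally show ?thesis .
qed

subsection \<open>Density of test functions\<close>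

text \<open>Young's inequality with a free parameter: the factor of the main term can be brought
  arbitrarily close to 1, as the density argument requires, while everything remains in terms of
  squares.\<close>

lemma add_square_le:
  fixes a b \<delta> :: real
  assumes "\<delta> > 0"
  shows "(a + b)\<^sup>2 \<le> (1 + \<delta>) * a\<^sup>2 + (1 + 1 / \<delta>) * b\<^sup>2"
proof -
  have "0 \<le> (\<delta> * a - b)\<^sup>2 / \<delta>" using assms by simp
  also have "\<dots> = \<delta> * a\<^sup>2 - 2 * a * b + b\<^sup>2 / \<delta>"
    using assms by (simp add: power2_eq_square field_simps)
  finally show ?thesis by (simp add: power2_sum algebra_simps)
qed

lemma L2_sq_on_add_le:
  fixes u v :: "'a::euclidean_space \<Rightarrow> real"
  assumes \<delta>: "\<delta> > 0" and [measurable]: "u \<in> borel_measurable borel" "v \<in> borel_measurable borel" "\<Omega> \<in> sets borel"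
  shows "L2_sq_on \<Omega> (\<lambda>x. u x + v x) \<le> ennreal (1 + \<delta>) * L2_sq_on \<Omega> u + ennreal (1 + 1 / \<delta>) * L2_sq_on \<Omega> v"
proof -
  have "L2_sq_on \<Omega> (\<lambda>x. u x + v x) \<le> (\<integral>\<^sup>+x. ennreal (1 + \<delta>) * (ennreal ((u x)\<^sup>2) * indicator \<Omega> x)
      + ennreal (1 + 1 / \<delta>) * (ennreal ((v x)\<^sup>2) * indicator \<Omega> x) \<partial>lborel)"
    unfolding L2_sq_on_def
  proof (intro nn_integral_mono)
    fix x
    show "ennreal ((u x + v x)\<^sup>2) * indicator \<Omega> x \<le> ennreal (1 + \<delta>) * (ennreal ((u x)\<^sup>2) * indicator \<Omega> x)
      + ennreal (1 + 1 / \<delta>) * (ennreal ((v x)\<^sup>2) * indicator \<Omega> x)"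
      using add_square_le[OF \<delta>, of "u x" "v x"] \<delta>
      by (cases "x \<in> \<Omega>") (simp_all add: ennreal_mult[symmetric] ennreal_plus[symmetric] ennreal_leI del: ennreal_plus)
  qed
  also have "\<dots> = ennreal (1 + \<delta>) * L2_sq_on \<Omega> u + ennreal (1 + 1 / \<delta>) * L2_sq_on \<Omega> v"
    unfolding L2_sq_on_def by (simp add: nn_integral_add nn_integral_cmult)
  finally show ?thesis .
qed

lemma gagliardo_sq_add_le:
  fixes u v :: "'a::euclidean_space \<Rightarrow> real"
  assumes \<delta>: "\<delta> > 0" and [measurable]: "u \<in> borel_measurable borel" "v \<in> borel_measurable borel"
  shows "(gagliardo_seminorm s (\<lambda>x. u x + v x))\<^sup>2
    \<le> ennreal (1 + \<delta>) * (gagliardo_seminorm s u)\<^sup>2 + ennreal (1 + 1 / \<delta>) * (gagliardo_seminorm s v)\<^sup>2"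
proof -
  define K where "K x y = ennreal (1 / norm (x - y) powr (real DIM('a) + 2 * s))" for x y :: 'a
  define C where "C = ennreal (C_const DIM('a) s / 2)"
  have [measurable]: "case_prod K \<in> borel_measurable (borel \<Otimes>\<^sub>M borel)"
    unfolding K_def by measurable
  have eq: "(gagliardo_seminorm s u)\<^sup>2 = C * (\<integral>\<^sup>+y. \<integral>\<^sup>+x. ennreal ((u x - u y)\<^sup>2) * K x y \<partial>lborel \<partial>lborel)"
    for u :: "'a \<Rightarrow> real"
    unfolding gagliardo_seminorm_def ennreal_sqrt_power2 C_def K_def
    by (simp add: ennreal_mult[symmetric])
  have "(\<integral>\<^sup>+y. \<integral>\<^sup>+x. ennreal (((u x + v x) - (u y + v y))\<^sup>2) * K x y \<partial>lborel \<partial>lborel)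
    \<le> (\<integral>\<^sup>+y. \<integral>\<^sup>+x. ennreal (1 + \<delta>) * (ennreal ((u x - u y)\<^sup>2) * K x y)
        + ennreal (1 + 1 / \<delta>) * (ennreal ((v x - v y)\<^sup>2) * K x y) \<partial>lborel \<partial>lborel)"
  proof (intro nn_integral_mono)
    fix x y
    have "ennreal (((u x + v x) - (u y + v y))\<^sup>2) \<le> ennreal ((1 + \<delta>) * (u x - u y)\<^sup>2 + (1 + 1 / \<delta>) * (v x - v y)\<^sup>2)"
      using add_square_le[OF \<delta>, of "u x - u y" "v x - v y"] by (intro ennreal_leI) (simp add: algebra_simps)
    then have "ennreal (((u x + v x) - (u y + v y))\<^sup>2) * K x y \<le> ennreal ((1 + \<delta>) * (u x - u y)\<^sup>2 + (1 + 1 / \<delta>) * (v x - v y)\<^sup>2) * K x y"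
      by (rule mult_right_mono) simp
    also have "\<dots> = ennreal (1 + \<delta>) * (ennreal ((u x - u y)\<^sup>2) * K x y) + ennreal (1 + 1 / \<delta>) * (ennreal ((v x - v y)\<^sup>2) * K x y)"
      using \<delta> by (subst ennreal_plus, simp, simp, subst ennreal_mult, simp, simp, subst ennreal_mult, simp, simp) (simp add: distrib_right mult.assoc)
    finally show "ennreal (((u x + v x) - (u y + v y))\<^sup>2) * K x y \<le> \<dots>" .
  qed
  also have "\<dots> = ennreal (1 + \<delta>) * (\<integral>\<^sup>+y. \<integral>\<^sup>+x. ennreal ((u x - u y)\<^sup>2) * K x y \<partial>lborel \<partial>lborel)
      + ennreal (1 + 1 / \<delta>) * (\<integral>\<^sup>+y. \<integral>\<^sup>+x. ennreal ((v x - v y)\<^sup>2) * K x y \<partial>lborel \<partial>lborel)"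
    by (simp add: nn_integral_add nn_integral_cmult)
  finally show ?thesis
    unfolding eq by (metis (no_types, lifting) distrib_left mult.left_commute mult_left_mono zero_le)
qed

section \<open>Basic properties of test functions\<close>

lemma Cc_infinity_continuous:
  assumes "u \<in> Cc_infinity \<Omega>"
  shows "continuous_on UNIV u"
proof -
  have "k_times_differentiable (Suc 0) u"
    using assms unfolding Cc_infinity_def by blast
  then show ?thesis
    by (auto intro!: continuous_at_imp_continuous_on differentiable_imp_continuous_within)
qed

lemma Cc_infinity_measurable: "u \<in> Cc_infinity \<Omega> \<Longrightarrow> u \<in> borel_measurable borel"
  using Cc_infinity_continuous borel_measurable_continuous_onI by blast

lemma Cc_infinity_zero: "u \<in> Cc_infinity \<Omega> \<Longrightarrow> x \<notin> \<Omega> \<Longrightarrow> u x = 0"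
  using closure_subset[of "{x. u x \<noteq> 0}"] unfolding Cc_infinity_def by auto

lemma continuous_compact_support_bounded:
  fixes u :: "'a::euclidean_space \<Rightarrow> real"
  assumes "continuous_on UNIV u" "compact (closure {x. u x \<noteq> 0})"
  obtains B where "B \<ge> 0" "\<And>x. \<bar>u x\<bar> \<le> B"
proof -
  have "compact (u ` closure {x. u x \<noteq> 0})"
    using assms by (intro compact_continuous_image) (auto intro: continuous_on_subset)
  then obtain B where "\<forall>x\<in>closure {x. u x \<noteq> 0}. \<bar>u x\<bar> \<le> B"
    by (auto dest!: compact_imp_bounded simp: bounded_iff)
  then have "\<bar>u x\<bar> \<le> max 0 B" for x
    using closure_subset[of "{x. u x \<noteq> 0}"] by (cases "u x = 0") (auto simp: le_max_iff_disj)
  then show ?thesis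
    using that[of "max 0 B"] by simp
qed

lemma L2_finite_compact_support:
  fixes u :: "'a::euclidean_space \<Rightarrow> real"
  assumes "continuous_on UNIV u" "compact (closure {x. u x \<noteq> 0})"
  shows "(\<integral>\<^sup>+x. ennreal ((u x)\<^sup>2) \<partial>lborel) < top"
proof -
  let ?K = "closure {x. u x \<noteq> 0}"
  obtain B where B: "B \<ge> 0" "\<And>x. \<bar>u x\<bar> \<le> B"
    using continuous_compact_support_bounded[OF assms] by blast
  have "(\<integral>\<^sup>+x. ennreal ((u x)\<^sup>2) \<partial>lborel) \<le> (\<integral>\<^sup>+x. ennreal (B\<^sup>2) * indicator ?K x \<partial>lborel)"
  proof (intro nn_integral_mono)
    fix x
    have "(u x)\<^sup>2 \<le> B\<^sup>2" using B(2)[of x] by (metis abs_le_square_iff abs_of_nonneg B(1))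
    then show "ennreal ((u x)\<^sup>2) \<le> ennreal (B\<^sup>2) * indicator ?K x"
      using closure_subset[of "{x. u x \<noteq> 0}"] by (cases "u x = 0") (auto simp: indicator_def ennreal_leI)
  qed
  also have "\<dots> = ennreal (B\<^sup>2) * emeasure lborel ?K"
    by (simp add: nn_integral_cmult_indicator)
  also have "\<dots> < top"
    using emeasure_compact_finite[OF assms(2)] by (simp add: ennreal_mult_less_top)
  finally show ?thesis .
qed

lemma Cc_infinity_L2_finite: "u \<in> Cc_infinity \<Omega> \<Longrightarrow> (\<integral>\<^sup>+x. ennreal ((u x)\<^sup>2) \<partial>lborel) < top"
  using L2_finite_compact_support[OF Cc_infinity_continuous] unfolding Cc_infinity_def by blast

lemma Cc_infinity_L2_sq_on:
  assumes "u \<in> Cc_infinity \<Omega>"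
  shows "L2_sq_on \<Omega> u = (\<integral>\<^sup>+x. ennreal ((u x)\<^sup>2) \<partial>lborel)"
  unfolding L2_sq_on_def
proof (intro nn_integral_cong)
  fix x
  show "ennreal ((u x)\<^sup>2) * indicator \<Omega> x = ennreal ((u x)\<^sup>2)"
    using Cc_infinity_zero[OF assms, of x] by (cases "x \<in> \<Omega>") auto
qed

lemma Cc_infinity_subset_Hs_space: "Cc_infinity \<Omega> \<subseteq> Hs_space s \<Omega>"
proof
  fix u assume u: "u \<in> Cc_infinity \<Omega>"
  have "Hs_norm s \<Omega> (\<lambda>x. u x - u x) = 0"
    by (simp add: Hs_norm_def gagliardo_seminorm_def L2_sq_on_def ennreal_sqrt_def)
  then show "u \<in> Hs_space s \<Omega>"
    using u Cc_infinity_zero[OF u] Cc_infinity_measurable[OF u] unfolding Hs_space_def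
    by (auto intro!: bexI[of _ u])
qed

section \<open>The Poincare inequality on test functions and on their closure\<close>

text \<open>The product form of the quotient bound also covers functions that are null almost
  everywhere: they do not compete in the infimum, but their left side is zero even if the infimum is
  infinite.\<close>

lemma poincare_sq_mult_le:
  assumes u: "u \<in> Cc_infinity \<Omega>"
  shows "poincare_sq s \<Omega> * L2_sq_on \<Omega> u \<le> (gagliardo_seminorm s u)\<^sup>2"
proof (cases "AE x in lborel. u x = 0")
  case True
  then have "(\<integral>\<^sup>+x. ennreal ((u x)\<^sup>2) \<partial>lborel) = (\<integral>\<^sup>+x. 0 \<partial>(lborel :: 'a measure))"
    by (intro nn_integral_cong_AE) auto
  then show ?thesis
    by (simp add: Cc_infinity_L2_sq_on[OF u])
next
  case False
  have [measurable]: "u \<in> borel_measurable borel" by (rule Cc_infinity_measurable[OF u])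
  have fin: "L2_sq_on \<Omega> u < top" "L2_sq_on \<Omega> u \<noteq> 0"
    using Cc_infinity_L2_finite[OF u] False by (simp_all add: Cc_infinity_L2_sq_on[OF u] nn_integral_0_iff_AE)
  have "poincare_sq s \<Omega> \<le> (gagliardo_seminorm s u)\<^sup>2 / L2_sq_on \<Omega> u"
    unfolding poincare_sq_def using u False Cc_infinity_subset_Hs_space by (intro INF_lower) auto
  then have "poincare_sq s \<Omega> * L2_sq_on \<Omega> u \<le> (gagliardo_seminorm s u)\<^sup>2 / L2_sq_on \<Omega> u * L2_sq_on \<Omega> u"
    by (rule mult_right_mono) simp
  also have "\<dots> = (gagliardo_seminorm s u)\<^sup>2"
    using fin by (simp add: ennreal_divide_times)
  finally show ?thesis .
qed

text \<open>Approximate \<open>u\<close> by a test function, compare both sides with factors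
  \<open>1 + \<delta>\<close>, and let \<delta> tend to 0. The constant \<open>m\<close> is real, so
  that the error terms multiplied by it tend to zero.\<close>

lemma poincare_inequality_extends_to_Hs_space:
  fixes \<Omega> :: "'a::euclidean_space set"
  assumes \<Omega>: "open \<Omega>" and m: "m \<ge> 0"
    and Cc: "\<And>\<phi>. \<phi> \<in> Cc_infinity \<Omega> \<Longrightarrow> ennreal m * L2_sq_on \<Omega> \<phi> \<le> (gagliardo_seminorm s \<phi>)\<^sup>2"
    and u: "u \<in> Hs_space s \<Omega>"
  shows "L2_sq_on \<Omega> u < top" "ennreal m * L2_sq_on \<Omega> u \<le> (gagliardo_seminorm s u)\<^sup>2"
proof -
  have [measurable]: "u \<in> borel_measurable borel" "\<Omega> \<in> sets borel"
    using u \<Omega> unfolding Hs_space_def by auto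
  have approx: "\<exists>\<phi>\<in>Cc_infinity \<Omega>. L2_sq_on \<Omega> (\<lambda>x. u x - \<phi> x) + (gagliardo_seminorm s (\<lambda>x. u x - \<phi> x))\<^sup>2 \<le> ennreal (\<delta>\<^sup>2)"
    if "\<delta> > 0" for \<delta>
  proof -
    have "ennreal \<delta> > 0"
      using that by simp
    then obtain \<phi> where \<phi>: "\<phi> \<in> Cc_infinity \<Omega>" "Hs_norm s \<Omega> (\<lambda>x. u x - \<phi> x) < ennreal \<delta>"
      using u unfolding Hs_space_def by blast
    from \<phi>(2) have "(Hs_norm s \<Omega> (\<lambda>x. u x - \<phi> x))\<^sup>2 \<le> (ennreal \<delta>)\<^sup>2"
      by (intro power_mono) auto
    then show ?thesis
      using \<phi>(1) that unfolding Hs_norm_def by (auto simp: ennreal_power)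
  qed
  have L: "L2_sq_on \<Omega> u \<le> ennreal (1 + \<delta>) * L2_sq_on \<Omega> \<phi> + ennreal (1 + 1 / \<delta>) * L2_sq_on \<Omega> (\<lambda>x. u x - \<phi> x)"
    if "\<delta> > 0" "\<phi> \<in> Cc_infinity \<Omega>" for \<delta> \<phi>
    using L2_sq_on_add_le[OF that(1), of \<phi> "\<lambda>x. u x - \<phi> x" \<Omega>] Cc_infinity_measurable[OF that(2)] by simp
  have G: "(gagliardo_seminorm s \<phi>)\<^sup>2 \<le> ennreal (1 + \<delta>) * (gagliardo_seminorm s u)\<^sup>2
      + ennreal (1 + 1 / \<delta>) * (gagliardo_seminorm s (\<lambda>x. u x - \<phi> x))\<^sup>2"
    if "\<delta> > 0" "\<phi> \<in> Cc_infinity \<Omega>" for \<delta> \<phi>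
  proof -
    have [measurable]: "\<phi> \<in> borel_measurable borel" by (rule Cc_infinity_measurable[OF that(2)])
    have abs_eq: "\<bar>(\<phi> x - u x) - (\<phi> y - u y)\<bar> = \<bar>(u x - \<phi> x) - (u y - \<phi> y)\<bar>" for x y
      by linarith
    have "gagliardo_seminorm s (\<lambda>x. \<phi> x - u x) = gagliardo_seminorm s (\<lambda>x. u x - \<phi> x)"
      unfolding gagliardo_seminorm_def by (simp only: abs_eq)
    then show ?thesis
      using gagliardo_sq_add_le[OF that(1), of u "\<lambda>x. \<phi> x - u x" s] by simp
  qed
  show fin: "L2_sq_on \<Omega> u < top"
  proof -
    obtain \<phi> where \<phi>: "\<phi> \<in> Cc_infinity \<Omega>"
      "L2_sq_on \<Omega> (\<lambda>x. u x - \<phi> x) + (gagliardo_seminorm s (\<lambda>x. u x - \<phi> x))\<^sup>2 \<le> ennreal (1\<^sup>2)"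
      using approx[of 1] by auto
    have "L2_sq_on \<Omega> (\<lambda>x. u x - \<phi> x) \<le> ennreal (1\<^sup>2)"
      by (rule order_trans[OF _ \<phi>(2)]) simp
    then have "L2_sq_on \<Omega> (\<lambda>x. u x - \<phi> x) < top"
      using le_less_trans ennreal_less_top by blast
    moreover have "L2_sq_on \<Omega> \<phi> < top"
      using Cc_infinity_L2_finite[OF \<phi>(1)] by (simp add: Cc_infinity_L2_sq_on[OF \<phi>(1)])
    ultimately show ?thesis
      using L[of 1 \<phi>] \<phi>(1) by (simp add: ennreal_mult_less_top le_less_trans)
  qed
  show "ennreal m * L2_sq_on \<Omega> u \<le> (gagliardo_seminorm s u)\<^sup>2"
  proof (cases "(gagliardo_seminorm s u)\<^sup>2 = top")
    case False
    then obtain g where g: "g \<ge> 0" "(gagliardo_seminorm s u)\<^sup>2 = ennreal g"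
      by (metis ennreal_cases)
    obtain l where l: "l \<ge> 0" "L2_sq_on \<Omega> u = ennreal l"
      using fin by (metis ennreal_cases less_irrefl)
    have bound: "m * l \<le> (1 + \<delta>) * ((1 + \<delta>) * g + (\<delta>\<^sup>2 + \<delta>)) + m * (\<delta>\<^sup>2 + \<delta>)" if \<delta>: "\<delta> > 0" for \<delta>
    proof -
      obtain \<phi> where \<phi>: "\<phi> \<in> Cc_infinity \<Omega>"
        "L2_sq_on \<Omega> (\<lambda>x. u x - \<phi> x) + (gagliardo_seminorm s (\<lambda>x. u x - \<phi> x))\<^sup>2 \<le> ennreal (\<delta>\<^sup>2)"
        using approx[OF \<delta>] by auto
      have L': "L2_sq_on \<Omega> (\<lambda>x. u x - \<phi> x) \<le> ennreal (\<delta>\<^sup>2)"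
        by (rule order_trans[OF _ \<phi>(2)]) simp
      have G': "(gagliardo_seminorm s (\<lambda>x. u x - \<phi> x))\<^sup>2 \<le> ennreal (\<delta>\<^sup>2)"
        by (rule order_trans[OF _ \<phi>(2)]) simp
      \<comment> \<open>Taking \<delta> both as the distance to the test function and as the
        parameter in Young's inequality keeps the error
        \<open>(1 + 1 / \<delta>) * \<delta>\<^sup>2\<close> small despite the large factor.\<close>
      have d: "(1 + 1 / \<delta>) * \<delta>\<^sup>2 = \<delta>\<^sup>2 + \<delta>"
        using \<delta> by (simp add: power2_eq_square field_simps)
      have d': "ennreal (1 + 1 / \<delta>) * ennreal (\<delta>\<^sup>2) = ennreal (\<delta>\<^sup>2 + \<delta>)"
        using \<delta> by (subst ennreal_mult[symmetric]) (simp_all add: d del: ennreal_plus)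
      have "ennreal m * ennreal l \<le> ennreal m * (ennreal (1 + \<delta>) * L2_sq_on \<Omega> \<phi> + ennreal (\<delta>\<^sup>2 + \<delta>))"
        unfolding l(2)[symmetric] d'[symmetric]
        by (intro mult_left_mono order_trans[OF L[OF \<delta> \<phi>(1)]] add_left_mono L') auto
      also have "\<dots> = ennreal (1 + \<delta>) * (ennreal m * L2_sq_on \<Omega> \<phi>) + ennreal m * ennreal (\<delta>\<^sup>2 + \<delta>)"
        by (simp add: distrib_left mult_ac)
      also have "\<dots> \<le> ennreal (1 + \<delta>) * (ennreal (1 + \<delta>) * ennreal g + ennreal (\<delta>\<^sup>2 + \<delta>)) + ennreal m * ennreal (\<delta>\<^sup>2 + \<delta>)"
        unfolding g(2)[symmetric] unfolding d'[symmetric]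
        by (intro mult_left_mono add_right_mono order_trans[OF Cc[OF \<phi>(1)]]
             order_trans[OF G[OF \<delta> \<phi>(1)]] add_left_mono G') auto
      also have "\<dots> = ennreal ((1 + \<delta>) * ((1 + \<delta>) * g + (\<delta>\<^sup>2 + \<delta>)) + m * (\<delta>\<^sup>2 + \<delta>))"
        using \<delta> g m by (simp add: ennreal_mult[symmetric] ennreal_plus[symmetric] del: ennreal_plus)
      finally show ?thesis
        using \<delta> g m l by (simp add: ennreal_mult[symmetric] ennreal_le_iff del: ennreal_plus)
    qed
    have "((\<lambda>\<delta>. (1 + \<delta>) * ((1 + \<delta>) * g + (\<delta>\<^sup>2 + \<delta>)) + m * (\<delta>\<^sup>2 + \<delta>))
        \<longlongrightarrow> (1 + 0) * ((1 + 0) * g + (0\<^sup>2 + 0)) + m * (0\<^sup>2 + 0)) (at_right 0)"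
      by (intro tendsto_intros)
    then have "m * l \<le> (1 + 0) * ((1 + 0) * g + (0\<^sup>2 + 0)) + m * (0\<^sup>2 + 0)"
      by (rule tendsto_lowerbound) (auto simp: eventually_at_right_less intro: eventually_at_right_less[THEN eventually_mono] bound)
    then show ?thesis
      using m l g by (simp add: ennreal_mult[symmetric])
  qed simp
qed

text \<open>Reduces lower bounds for the infimum to test functions by the preceding extension. As
  \<open>M\<close> may be infinite, it is approached from below by finite constants.\<close>

lemma poincare_sq_geI:
  fixes \<Omega> :: "'a::euclidean_space set"
  assumes \<Omega>: "open \<Omega>"
    and Cc: "\<And>\<phi>. \<phi> \<in> Cc_infinity \<Omega> \<Longrightarrow> M * L2_sq_on \<Omega> \<phi> \<le> (gagliardo_seminorm s \<phi>)\<^sup>2"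
  shows "M \<le> poincare_sq s \<Omega>"
proof (rule dense_le)
  fix M' assume "M' < M"
  then obtain m where m: "m \<ge> 0" "M' = ennreal m"
    by (metis ennreal_cases less_le_not_le top_greatest)
  have C: "ennreal m * L2_sq_on \<Omega> \<phi> \<le> (gagliardo_seminorm s \<phi>)\<^sup>2" if "\<phi> \<in> Cc_infinity \<Omega>" for \<phi>
    using Cc[OF that] \<open>M' < M\<close> unfolding m(2) by (meson less_imp_le mult_right_mono order_trans zero_le)
  show "M' \<le> poincare_sq s \<Omega>"
    unfolding poincare_sq_def
  proof (rule INF_greatest)
    fix u assume u: "u \<in> {u \<in> Hs_space s \<Omega>. \<not> (AE x in lborel. u x = 0)}"
    then have [measurable]: "u \<in> borel_measurable borel" "\<Omega> \<in> sets borel"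
      using \<Omega> unfolding Hs_space_def by auto
    note * = poincare_inequality_extends_to_Hs_space[OF \<Omega> m(1) C, of u]
    \<comment> \<open>Members of \<open>Hs_space\<close> vanish almost everywhere off the domain, so
      a zero norm on the domain would make \<open>u\<close> null everywhere.\<close>
    have "L2_sq_on \<Omega> u \<noteq> 0"
    proof
      assume "L2_sq_on \<Omega> u = 0"
      then have "AE x in lborel. x \<in> \<Omega> \<longrightarrow> u x = 0"
        unfolding L2_sq_on_def by (subst (asm) nn_integral_0_iff_AE) (auto elim!: AE_mp simp: indicator_def)
      moreover have "AE x in lborel. x \<notin> \<Omega> \<longrightarrow> u x = 0"
        using u unfolding Hs_space_def by blast
      ultimately have "AE x in lborel. u x = 0"
        by eventually_elim auto
      then show False using u by blast
    qed
    moreover have "M' * L2_sq_on \<Omega> u / L2_sq_on \<Omega> u \<le> (gagliardo_seminorm s u)\<^sup>2 / L2_sq_on \<Omega> u"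
      using u * unfolding m(2) by (intro divide_right_mono_ennreal) auto
    ultimately show "M' \<le> (gagliardo_seminorm s u)\<^sup>2 / L2_sq_on \<Omega> u"
      using u * by (simp add: mult_divide_eq_ennreal)
  qed
qed

subsection \<open>Test functions\<close>

lemma k_times_differentiable_Suc_imp: "k_times_differentiable (Suc k) u \<Longrightarrow> k_times_differentiable k u"
proof (induction k arbitrary: u)
  case (Suc k)
  then show ?case
    by (metis k_times_differentiable.simps(2))
qed simp

lemma k_times_differentiable_const: "k_times_differentiable k (\<lambda>x. c)"
  by (induction k arbitrary: c) simp_all

lemma k_times_differentiable_add:
  "k_times_differentiable k f \<Longrightarrow> k_times_differentiable k g \<Longrightarrow> k_times_differentiable k (\<lambda>x. f x + g x)"
proof (induction k arbitrary: f g)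
  case (Suc k)
  then have d: "\<And>x. f differentiable (at x)" "\<And>x. g differentiable (at x)" by auto
  have "frechet_derivative (\<lambda>x. f x + g x) (at x) v
      = frechet_derivative f (at x) v + frechet_derivative g (at x) v" for x v
    by (subst frechet_derivative_at[symmetric, OF has_derivative_add])
       (use d in \<open>auto simp: frechet_derivative_works[symmetric]\<close>)
  then show ?case
    using Suc d by auto
qed simp

lemma k_times_differentiable_mult:
  "k_times_differentiable k f \<Longrightarrow> k_times_differentiable k g \<Longrightarrow> k_times_differentiable k (\<lambda>x. f x * g x)"
proof (induction k arbitrary: f g)
  case (Suc k)
  then have d: "\<And>x. f differentiable (at x)" "\<And>x. g differentiable (at x)" by auto
  have eq: "frechet_derivative (\<lambda>x. f x * g x) (at x) v
      = f x * frechet_derivative g (at x) v + frechet_derivative f (at x) v * g x" for x v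
    by (subst frechet_derivative_at[symmetric, OF has_derivative_mult])
       (use d in \<open>auto simp: frechet_derivative_works[symmetric]\<close>)
  have "k_times_differentiable k f" "k_times_differentiable k g"
    using Suc.prems k_times_differentiable_Suc_imp by blast+
  then have "k_times_differentiable k (\<lambda>x. frechet_derivative (\<lambda>x. f x * g x) (at x) v)" for v
    unfolding eq using Suc by (intro k_times_differentiable_add Suc.IH) auto
  then show ?case
    using d by auto
qed simp

lemma k_times_differentiable_prod:
  "finite I \<Longrightarrow> (\<And>i. i \<in> I \<Longrightarrow> k_times_differentiable k (f i)) \<Longrightarrow> k_times_differentiable k (\<lambda>x. \<Prod>i\<in>I. f i x)"
  by (induction I rule: finite_induct) (auto intro: k_times_differentiable_const k_times_differentiable_mult)

text \<open>One chain rule for slices, tensor factors, dilations and restrictions to lines, all of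
  them compositions with affine maps. The derivative in direction \<open>v\<close> is the derivative
  of \<open>f\<close> in the fixed direction \<open>L v\<close>, composed with the same map, so the
  induction closes.\<close>

lemma k_times_differentiable_affine:
  assumes L: "bounded_linear L"
  shows "k_times_differentiable k f \<Longrightarrow> k_times_differentiable k (\<lambda>x. f (c + L x))"
proof (induction k arbitrary: f)
  case (Suc k)
  have L': "((\<lambda>x. c + L x) has_derivative L) (at x)" for x
    using has_derivative_add[OF has_derivative_const[of c] bounded_linear_imp_has_derivative[OF L]] by simp
  have D: "((\<lambda>x. f (c + L x)) has_derivative (\<lambda>v. frechet_derivative f (at (c + L x)) (L v))) (at x)" for x
  proof -
    have "(f has_derivative frechet_derivative f (at (c + L x))) (at (c + L x))"
      using Suc.prems by (simp add: frechet_derivative_works[symmetric])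
    from has_derivative_compose[OF L' this] show ?thesis .
  qed
  then have "frechet_derivative (\<lambda>x. f (c + L x)) (at x) = (\<lambda>v. frechet_derivative f (at (c + L x)) (L v))" for x
    by (metis frechet_derivative_at)
  moreover have "k_times_differentiable k (\<lambda>x. frechet_derivative f (at (c + L x)) (L v))" for v
    using Suc.prems by (intro Suc.IH[of "\<lambda>x. frechet_derivative f (at x) (L v)"]) auto
  ultimately show ?case
    using D by (auto simp: differentiable_def)
qed simp

section \<open>Slices, tensor products, dilations and bumps in \<open>Cc_infinity\<close>\<close>

text \<open>Any convenient compact set, such as a box, a product or an image, may stand in for the
  exact support.\<close>

lemma Cc_infinityI:
  assumes "\<And>k. k_times_differentiable k u" "compact K" "K \<subseteq> \<Omega>" "\<And>x. u x \<noteq> 0 \<Longrightarrow> x \<in> K"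
  shows "u \<in> Cc_infinity \<Omega>"
proof -
  have "closure {x. u x \<noteq> 0} \<subseteq> K"
    using assms by (intro closure_minimal compact_imp_closed) auto
  moreover then have "compact (closure {x. u x \<noteq> 0})"
    using assms(2) by (metis closed_closure compact_Int_closed inf.absorb2)
  ultimately show ?thesis
    using assms unfolding Cc_infinity_def by auto
qed

lemma Cc_infinityE:
  assumes "u \<in> Cc_infinity \<Omega>"
  obtains K where "\<And>k. k_times_differentiable k u" "compact K" "K \<subseteq> \<Omega>" "\<And>x. u x \<noteq> 0 \<Longrightarrow> x \<in> K"
  using assms closure_subset[of "{x. u x \<noteq> 0}"] unfolding Cc_infinity_def by blast

lemma Cc_infinity_slice:
  fixes \<phi> :: "'a::euclidean_space \<times> 'b::euclidean_space \<Rightarrow> real"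
  assumes "\<phi> \<in> Cc_infinity (A \<times> B)"
  shows "(\<lambda>y. \<phi> (x, y)) \<in> Cc_infinity B"
proof -
  obtain K where K: "\<And>k. k_times_differentiable k \<phi>" "compact K" "K \<subseteq> A \<times> B" "\<And>p. \<phi> p \<noteq> 0 \<Longrightarrow> p \<in> K"
    using assms by (rule Cc_infinityE) blast
  have "bounded_linear (\<lambda>y::'b. (0::'a, y))"
    by (simp add: bounded_linear_Pair bounded_linear_zero bounded_linear_ident)
  from k_times_differentiable_affine[OF this K(1), of _ "(x, 0)"]
  have "k_times_differentiable k (\<lambda>y. \<phi> (x, y))" for k
    by simp
  moreover have "compact (snd ` K)"
    by (intro compact_continuous_image continuous_intros K)
  moreover have "snd ` K \<subseteq> B" "\<And>y. \<phi> (x, y) \<noteq> 0 \<Longrightarrow> y \<in> snd ` K"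
    using K(3,4) by force+
  ultimately show ?thesis
    by (rule Cc_infinityI)
qed

lemma Cc_infinity_tensor:
  fixes f :: "'a::euclidean_space \<Rightarrow> real" and g :: "'b::euclidean_space \<Rightarrow> real"
  assumes "f \<in> Cc_infinity A" "g \<in> Cc_infinity B"
  shows "(\<lambda>(x, y). f x * g y) \<in> Cc_infinity (A \<times> B)"
proof -
  obtain K where K: "\<And>k. k_times_differentiable k f" "compact K" "K \<subseteq> A" "\<And>x. f x \<noteq> 0 \<Longrightarrow> x \<in> K"
    using assms(1) by (rule Cc_infinityE) blast
  obtain K' where K': "\<And>k. k_times_differentiable k g" "compact K'" "K' \<subseteq> B" "\<And>x. g x \<noteq> 0 \<Longrightarrow> x \<in> K'"
    using assms(2) by (rule Cc_infinityE) blast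
  \<comment> \<open>The idle \<open>0 +\<close> matches the pattern \<open>c + L x\<close> of
    \<open>k_times_differentiable_affine\<close>.\<close>
  have "k_times_differentiable k (\<lambda>p. f (0 + fst p) * g (0 + snd p))" for k
    by (intro k_times_differentiable_mult k_times_differentiable_affine K K' bounded_linear_fst bounded_linear_snd)
  then have "k_times_differentiable k (\<lambda>(x, y). f x * g y)" for k
    by (simp add: case_prod_beta')
  moreover have "compact (K \<times> K')" "K \<times> K' \<subseteq> A \<times> B"
    using K K' by (auto intro: compact_Times)
  ultimately show ?thesis
    using K(4) K'(4) by (intro Cc_infinityI[of _ "K \<times> K'"]) auto
qed

lemma Cc_infinity_scale:
  fixes f :: "'a::euclidean_space \<Rightarrow> real"
  assumes "f \<in> Cc_infinity UNIV" "R > 0"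
  shows "(\<lambda>x. f (x /\<^sub>R R)) \<in> Cc_infinity UNIV"
proof -
  obtain K where K: "\<And>k. k_times_differentiable k f" "compact K" "K \<subseteq> UNIV" "\<And>x. f x \<noteq> 0 \<Longrightarrow> x \<in> K"
    using assms(1) by (rule Cc_infinityE) blast
  have "k_times_differentiable k (\<lambda>x. f (0 + x /\<^sub>R R))" for k
    by (intro k_times_differentiable_affine K bounded_linear_scaleR_right)
  moreover have "compact ((\<lambda>x. R *\<^sub>R x) ` K)"
    by (intro compact_scaling K)
  moreover have "x \<in> (\<lambda>x. R *\<^sub>R x) ` K" if "f (x /\<^sub>R R) \<noteq> 0" for x
    using K(4)[OF that] assms(2) by (intro image_eqI[of _ _ "x /\<^sub>R R"]) auto
  ultimately show ?thesis
    by (intro Cc_infinityI[of _ "(\<lambda>x. R *\<^sub>R x) ` K"]) auto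
qed

text \<open>
  A bump function on one space yields one on any other: multiply its restrictions to a line over
  all coordinates.
\<close>

lemma Cc_infinity_nonzero_transfer:
  fixes \<psi> :: "'b::euclidean_space \<Rightarrow> real"
  assumes "\<psi> \<in> Cc_infinity \<Omega>" "\<psi> y0 \<noteq> 0"
  obtains f :: "'a::euclidean_space \<Rightarrow> real" and x0 where "f \<in> Cc_infinity UNIV" "f x0 \<noteq> 0"
proof -
  obtain K where K: "\<And>k. k_times_differentiable k \<psi>" "compact K" "K \<subseteq> \<Omega>" "\<And>x. \<psi> x \<noteq> 0 \<Longrightarrow> x \<in> K"
    using assms(1) by (rule Cc_infinityE) blast
  obtain C where C: "\<And>y. y \<in> K \<Longrightarrow> norm y \<le> C"
    using compact_imp_bounded[OF K(2)] unfolding bounded_iff by blast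
  obtain e :: 'b where e: "e \<in> Basis" using nonempty_Basis by blast
  define f where "f x = (\<Prod>i\<in>Basis. \<psi> (y0 + (x \<bullet> i) *\<^sub>R e))" for x :: 'a
  have "bounded_linear (\<lambda>x. (x \<bullet> i) *\<^sub>R e)" for i :: 'a
    by (intro bounded_linear_intros)
  then have "k_times_differentiable k f" for k
    unfolding f_def by (intro k_times_differentiable_prod k_times_differentiable_affine K) simp_all
  \<comment> \<open>If \<open>f x \<noteq> 0\<close>, no factor vanishes, so for each coordinate the
    point on the line lies in \<open>K\<close>. This bounds that coordinate by
    \<open>C + norm y0\<close>.\<close>
  moreover have "x \<in> cbox (- (C + norm y0) *\<^sub>R One) ((C + norm y0) *\<^sub>R One)" if "f x \<noteq> 0" for x
  proof -
    have "- (C + norm y0) \<le> x \<bullet> i \<and> x \<bullet> i \<le> C + norm y0" if "i \<in> Basis" for i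
    proof -
      have "\<psi> (y0 + (x \<bullet> i) *\<^sub>R e) \<noteq> 0"
        using \<open>f x \<noteq> 0\<close> that unfolding f_def by auto
      then have "norm (y0 + (x \<bullet> i) *\<^sub>R e) \<le> C"
        using C K(4) by blast
      moreover have "norm ((x \<bullet> i) *\<^sub>R e) \<le> norm (y0 + (x \<bullet> i) *\<^sub>R e) + norm y0"
        by (metis add_diff_cancel_left' norm_triangle_ineq4)
      ultimately have "\<bar>x \<bullet> i\<bar> \<le> C + norm y0"
        using e by simp
      then show ?thesis
        by linarith
    qed
    then show ?thesis
      by (auto simp: mem_box)
  qed
  ultimately have "f \<in> Cc_infinity UNIV"
    by (intro Cc_infinityI[OF _ compact_cbox]) auto
  moreover have "f 0 \<noteq> 0"
    using assms(2) by (simp add: f_def)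
  ultimately show ?thesis
    by (rule that)
qed

text \<open>The partial derivatives are continuous and vanish off the compact set \<open>K\<close>,
  hence are bounded. Their bounds add up to a bound on the operator norm of the derivative.\<close>

lemma Cc_infinity_Lipschitz:
  fixes f :: "'a::euclidean_space \<Rightarrow> real"
  assumes "f \<in> Cc_infinity \<Omega>"
  obtains L where "L \<ge> 0" "\<And>x y. \<bar>f x - f y\<bar> \<le> L * norm (x - y)"
proof -
  obtain K where K: "\<And>k. k_times_differentiable k f" "compact K" "K \<subseteq> \<Omega>" "\<And>x. f x \<noteq> 0 \<Longrightarrow> x \<in> K"
    using assms by (rule Cc_infinityE) blast
  define D where "D i x = frechet_derivative f (at x) i" for i x
  have "\<exists>B\<ge>0. \<forall>x. \<bar>D i x\<bar> \<le> B" for i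
  proof -
    have "k_times_differentiable (Suc 0) (D i)"
      using K(1)[of "Suc (Suc 0)"] by (simp add: D_def[abs_def])
    then have "continuous_on UNIV (D i)"
      by (auto intro!: continuous_at_imp_continuous_on differentiable_imp_continuous_within)
    moreover have "D i x = 0" if "x \<notin> K" for x
    proof -
      \<comment> \<open>The complement of \<open>K\<close> is open, so \<open>f\<close> is zero in a
        neighbourhood of \<open>x\<close>.\<close>
      have "(f has_derivative (\<lambda>_. 0)) (at x)"
        by (rule has_derivative_transform_within_open[of "\<lambda>_. 0" _ _ _ "- K"])
           (use K(2,4) that in \<open>auto intro: compact_imp_closed\<close>)
      then show ?thesis
        unfolding D_def by (simp add: frechet_derivative_at[symmetric])
    qed
    then have "{x. D i x \<noteq> 0} \<subseteq> K"
      by auto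
    then have "closure {x. D i x \<noteq> 0} \<subseteq> K"
      using K(2) by (intro closure_minimal compact_imp_closed)
    then have "compact (closure {x. D i x \<noteq> 0})"
      using K(2) by (metis closed_closure compact_Int_closed inf.absorb2)
    ultimately show ?thesis
      using continuous_compact_support_bounded by metis
  qed
  then obtain B where B: "\<And>i. B i \<ge> 0" "\<And>i x. \<bar>D i x\<bar> \<le> B i"
    by metis
  have der: "(f has_derivative frechet_derivative f (at x)) (at x)" for x
    using K(1)[of "Suc 0"] by (simp add: frechet_derivative_works[symmetric])
  have "onorm (frechet_derivative f (at x)) \<le> (\<Sum>i\<in>Basis. B i)" for x
  proof (rule onorm_bound)
    fix h :: 'a
    have lin: "linear (frechet_derivative f (at x))"
      using der[of x] by (rule has_derivative_linear)
    have "frechet_derivative f (at x) h = (\<Sum>i\<in>Basis. (h \<bullet> i) * D i x)"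
      unfolding D_def by (subst (1) euclidean_representation[of h, symmetric])
        (simp add: linear_sum[OF lin] linear_cmul[OF lin])
    also have "norm \<dots> \<le> (\<Sum>i\<in>Basis. norm h * B i)"
      by (intro sum_norm_le) (auto simp: abs_mult Basis_le_norm intro!: mult_mono B)
    finally show "norm (frechet_derivative f (at x) h) \<le> (\<Sum>i\<in>Basis. B i) * norm h"
      by (simp add: sum_distrib_left mult.commute)
  qed (simp add: B sum_nonneg)
  then have "norm (f x - f y) \<le> (\<Sum>i\<in>Basis. B i) * norm (x - y)" for x y
    by (intro differentiable_bound[of UNIV f]) (auto intro: der)
  then show ?thesis
    using that[of "\<Sum>i\<in>Basis. B i"] B by (auto simp: sum_nonneg)
qed

subsection \<open>Energy of dilated test functions\<close>

text \<open>From \<open>y \<le> exp y\<close> at \<open>y = t * q / 2\<close>: the factor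
  \<open>q\<close> is absorbed by half of the exponent at the price \<open>2 / t\<close>. Passing to
  parameter \<open>t / 2\<close> costs \<open>2 powr (n / 2)\<close> in the normalisation.\<close>

lemma norm_sq_heat_le:
  fixes h :: "'a::euclidean_space"
  assumes t: "t > 0"
  shows "ennreal ((norm h)\<^sup>2) * heat t h \<le> ennreal (2 * 2 powr (real DIM('a) / 2) / t) * heat (t / 2) h"
proof -
  define p where "p = real DIM('a) / 2"
  define q where "q = (norm h)\<^sup>2"
  have "t * q / 2 \<le> exp (t * q / 2)"
    using exp_ge_add_one_self[of "t * q / 2"] by linarith
  then have "t * q / 2 * exp (- t * q) \<le> exp (t * q / 2) * exp (- t * q)"
    by (rule mult_right_mono) simp
  also have "\<dots> = exp (- (t / 2) * q)"
    by (simp add: mult_exp_exp)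
  finally have "q * exp (- t * q) \<le> 2 / t * exp (- (t / 2) * q)"
    using t by (simp add: field_simps)
  then have "(t / pi) powr p * (q * exp (- t * q)) \<le> (t / pi) powr p * (2 / t * exp (- (t / 2) * q))"
    by (rule mult_left_mono) simp
  moreover have "(t / pi) powr p = 2 powr p * (t / 2 / pi) powr p"
    using t by (simp add: powr_mult[symmetric])
  ultimately have "q * ((t / pi) powr p * exp (- t * q)) \<le> 2 * 2 powr p / t * ((t / 2 / pi) powr p * exp (- (t / 2) * q))"
    by (simp add: mult_ac)
  then show ?thesis
    unfolding heat_def p_def[symmetric] q_def[symmetric] using t
    by (subst (1 2) ennreal_mult[symmetric]) (auto simp: q_def intro!: ennreal_leI)
qed

text \<open>A bound uniform in \<open>t\<close>, meant for small \<open>t\<close>.\<close>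

lemma heat_energy_le_L2:
  fixes f :: "'a::euclidean_space \<Rightarrow> real"
  assumes t: "t > 0" and [measurable]: "f \<in> borel_measurable borel"
  shows "heat_energy t f f \<le> 4 * (\<integral>\<^sup>+x. ennreal ((f x)\<^sup>2) \<partial>lborel)"
proof -
  have "heat_energy t f f \<le> heat_mean t (\<lambda>x y. 2 * ennreal ((f x)\<^sup>2) + 2 * ennreal ((f y)\<^sup>2))"
    unfolding heat_energy_eq_mean
  proof (rule heat_mean_mono)
    fix x y
    have "(f x - f y)\<^sup>2 \<le> 2 * (f x)\<^sup>2 + 2 * (f y)\<^sup>2"
      using zero_le_power2[of "f x + f y"] by (simp add: power2_eq_square algebra_simps)
    then have "ennreal ((f x - f y)\<^sup>2) \<le> ennreal (2 * (f x)\<^sup>2 + 2 * (f y)\<^sup>2)"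
      by (rule ennreal_leI)
    then show "ennreal ((f x - f y)\<^sup>2) \<le> 2 * ennreal ((f x)\<^sup>2) + 2 * ennreal ((f y)\<^sup>2)"
      by (simp add: ennreal_mult)
  qed
  also have "\<dots> = 2 * (\<integral>\<^sup>+x. ennreal ((f x)\<^sup>2) \<partial>lborel) + 2 * (\<integral>\<^sup>+x. ennreal ((f x)\<^sup>2) \<partial>lborel)"
    using t by (simp add: heat_mean_add heat_mean_cmult heat_mean_fst heat_mean_snd)
  also have "\<dots> = 4 * (\<integral>\<^sup>+x. ennreal ((f x)\<^sup>2) \<partial>lborel)"
    by (simp add: distrib_right[symmetric])
  finally show ?thesis .
qed

text \<open>Decay of order \<open>1 / t\<close>, meant for large \<open>t\<close>. The integrand is
  nonzero only if one of the two points lies in \<open>K\<close>; each of the two indicators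
  contributes the measure of \<open>K\<close>, by unit mass.\<close>

lemma heat_energy_le_Lipschitz:
  fixes f :: "'a::euclidean_space \<Rightarrow> real"
  assumes t: "t > 0" and K: "compact K" "\<And>x. f x \<noteq> 0 \<Longrightarrow> x \<in> K"
    and L: "L \<ge> 0" "\<And>x y. \<bar>f x - f y\<bar> \<le> L * norm (x - y)"
  shows "heat_energy t f f \<le> ennreal (4 * L\<^sup>2 * 2 powr (real DIM('a) / 2) * measure lborel K / t)"
proof -
  define c where "c = 2 * 2 powr (real DIM('a) / 2) / t"
  have [measurable]: "K \<in> sets borel" using K(1) by (simp add: borel_compact)
  have "heat_energy t f f \<le> (\<integral>\<^sup>+y. \<integral>\<^sup>+x. (ennreal (L\<^sup>2 * c) * (indicator K x + indicator K y)) * heat (t / 2) (x - y) \<partial>lborel \<partial>lborel)"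
    unfolding heat_energy_def
  proof (intro nn_integral_mono)
    fix x y
    show "ennreal ((f x - f y)\<^sup>2) * heat t (x - y) \<le> (ennreal (L\<^sup>2 * c) * (indicator K x + indicator K y)) * heat (t / 2) (x - y)"
    proof (cases "x \<in> K \<or> y \<in> K")
      case True
      have "(f x - f y)\<^sup>2 \<le> (L * norm (x - y))\<^sup>2"
        using power_mono[OF L(2)[of x y], of 2] by simp
      then have "ennreal ((f x - f y)\<^sup>2) * heat t (x - y) \<le> ennreal (L\<^sup>2 * (norm (x - y))\<^sup>2) * heat t (x - y)"
        by (intro mult_right_mono ennreal_leI) (simp_all add: power_mult_distrib)
      also have "\<dots> = ennreal (L\<^sup>2) * (ennreal ((norm (x - y))\<^sup>2) * heat t (x - y))"
        by (simp add: ennreal_mult mult.assoc)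
      also have "\<dots> \<le> ennreal (L\<^sup>2) * (ennreal c * heat (t / 2) (x - y))"
        unfolding c_def by (intro mult_left_mono norm_sq_heat_le t) simp
      also have "\<dots> = (ennreal (L\<^sup>2 * c) * 1) * heat (t / 2) (x - y)"
        using t by (subst ennreal_mult) (simp_all add: c_def mult.assoc)
      also have "\<dots> \<le> (ennreal (L\<^sup>2 * c) * (indicator K x + indicator K y)) * heat (t / 2) (x - y)"
        using True by (intro mult_right_mono mult_left_mono) (auto simp: indicator_def)
      finally show ?thesis .
    next
      case False
      then have "f x = 0" "f y = 0" using K(2) by blast+
      then show ?thesis by simp
    qed
  qed
  also have "\<dots> = heat_mean (t / 2) (\<lambda>x y. ennreal (L\<^sup>2 * c) * (indicator K x + indicator K y))"
    by (simp add: heat_mean_def)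
  also have "\<dots> = ennreal (L\<^sup>2 * c) * (emeasure lborel K + emeasure lborel K)"
    using t by (simp add: heat_mean_cmult heat_mean_add heat_mean_fst heat_mean_snd)
  also have "\<dots> = ennreal (L\<^sup>2 * c * (measure lborel K + measure lborel K))"
    using emeasure_compact_finite[OF K(1)] t
    by (simp add: emeasure_eq_ennreal_measure ennreal_mult[symmetric] ennreal_plus[symmetric] c_def del: ennreal_plus)
  also have "L\<^sup>2 * c * (measure lborel K + measure lborel K) = 4 * L\<^sup>2 * 2 powr (real DIM('a) / 2) * measure lborel K / t"
    by (simp add: c_def)
  finally show ?thesis .
qed

text \<open>Split the integral over \<open>t\<close> at 1. Below, the energy is bounded and
  \<open>t powr (s - 1)\<close> is integrable since \<open>s > 0\<close>; above, the decay of the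
  energy turns the weight into \<open>t powr (s - 2)\<close>, integrable since
  \<open>s < 1\<close>.\<close>

lemma Cc_infinity_gagliardo_finite:
  fixes f :: "'a::euclidean_space \<Rightarrow> real"
  assumes s: "0 < s" "s < 1" and f: "f \<in> Cc_infinity \<Omega>"
  shows "(gagliardo_seminorm s f)\<^sup>2 < top"
proof -
  have [measurable]: "f \<in> borel_measurable borel" by (rule Cc_infinity_measurable[OF f])
  obtain L where L: "L \<ge> 0" "\<And>x y. \<bar>f x - f y\<bar> \<le> L * norm (x - y)"
    using Cc_infinity_Lipschitz[OF f] by blast
  obtain K where K: "compact K" "\<And>x. f x \<noteq> 0 \<Longrightarrow> x \<in> K"
    using f by (rule Cc_infinityE) blast
  define d where "d = D_const s / 2"
  have d: "d > 0" using D_const_pos[OF s] by (simp add: d_def)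
  define A where "A = 4 * (\<integral>\<^sup>+x. ennreal ((f x)\<^sup>2) \<partial>lborel)"
  define B where "B = 4 * L\<^sup>2 * 2 powr (real DIM('a) / 2) * measure lborel K"
  have A: "A < top" using Cc_infinity_L2_finite[OF f] by (simp add: A_def ennreal_mult_less_top)
  have B: "B \<ge> 0" using L by (simp add: B_def)
  have "((\<lambda>t. t powr (s - 1)) has_integral (1 powr (s - 1 + 1) / (s - 1 + 1))) {0..1}"
    using s by (intro has_integral_powr_from_0) auto
  from nn_integral_has_integral_lebesgue[OF _ this]
  have I0: "(\<integral>\<^sup>+t. ennreal (indicator {0..1} t * t powr (s - 1)) \<partial>lborel) = ennreal (1 / s)"
    by simp
  have "((\<lambda>t. t powr (s - 2)) has_integral (- (1 powr (s - 2 + 1)) / (s - 2 + 1))) {1..}"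
    using s by (intro has_integral_powr_to_inf) auto
  from nn_integral_has_integral_lebesgue[OF _ this]
  have I1: "(\<integral>\<^sup>+t. ennreal (indicator {1..} t * t powr (s - 2)) \<partial>lborel) < top"
    by simp
  have "(gagliardo_seminorm s f)\<^sup>2 \<le> (\<integral>\<^sup>+t. ennreal d * A * ennreal (indicator {0..1} t * t powr (s - 1))
      + ennreal (d * B) * ennreal (indicator {1..} t * t powr (s - 2)) \<partial>lborel)"
    unfolding gagliardo_eq_heat_energy[OF s Cc_infinity_measurable[OF f]] d_def[symmetric]
  proof (intro nn_integral_mono)
    fix t :: real
    show "ennreal (d * t powr (s - 1)) * heat_energy t f f * indicator {0<..} t
      \<le> ennreal d * A * ennreal (indicator {0..1} t * t powr (s - 1)) + ennreal (d * B) * ennreal (indicator {1..} t * t powr (s - 2))"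
    proof -
      consider "t \<le> 0" | "0 < t" "t \<le> 1" | "1 < t" by linarith
      then show ?thesis
      proof cases
        case 2
        have "ennreal (d * t powr (s - 1)) * heat_energy t f f \<le> ennreal (d * t powr (s - 1)) * A"
          unfolding A_def using 2 by (intro mult_left_mono heat_energy_le_L2) auto
        also have "\<dots> = ennreal d * A * ennreal (indicator {0..1} t * t powr (s - 1))"
          using 2 d by (simp add: ennreal_mult mult_ac)
        finally show ?thesis
          using 2 by (auto intro: add_increasing2)
      next
        case 3
        have "ennreal (d * t powr (s - 1)) * heat_energy t f f \<le> ennreal (d * t powr (s - 1)) * ennreal (B / t)"
          unfolding B_def using 3 by (intro mult_left_mono heat_energy_le_Lipschitz K L) auto
        also have "\<dots> = ennreal (d * B * (t powr (s - 1) / t))"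
          using 3 d B by (simp add: ennreal_mult[symmetric] mult_ac)
        also have "t powr (s - 1) / t = indicator {1..} t * t powr (s - 2)"
          using 3 by (simp add: powr_diff field_simps power2_eq_square)
        also have "ennreal (d * B * (indicator {1..} t * t powr (s - 2))) = ennreal (d * B) * ennreal (indicator {1..} t * t powr (s - 2))"
          using d B by (intro ennreal_mult) auto
        finally show ?thesis
          using 3 by (auto intro: add_increasing)
      qed simp
    qed
  qed
  also have "\<dots> = ennreal d * A * ennreal (1 / s) + ennreal (d * B) * (\<integral>\<^sup>+t. ennreal (indicator {1..} t * t powr (s - 2)) \<partial>lborel)"
    by (simp only: I0[symmetric]) (subst nn_integral_add; simp add: nn_integral_cmult)
  also have "\<dots> < top"
    using A I1 by (simp add: ennreal_mult_less_top)
  finally show ?thesis .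
qed

section \<open>Dilations\<close>

lemma nn_integral_lborel_scale:
  fixes F :: "'a::euclidean_space \<Rightarrow> ennreal"
  assumes R: "R > 0" and [measurable]: "F \<in> borel_measurable borel"
  shows "(\<integral>\<^sup>+x. F x \<partial>lborel) = ennreal (R ^ DIM('a)) * (\<integral>\<^sup>+x. F (R *\<^sub>R x) \<partial>lborel)"
proof -
  have "R \<noteq> 0" using R by simp
  then have "(\<integral>\<^sup>+x. F x \<partial>lborel) = (\<integral>\<^sup>+x. F x \<partial>density (distr lborel borel (\<lambda>x. 0 + R *\<^sub>R x)) (\<lambda>_. ennreal (\<bar>R\<bar> ^ DIM('a))))"
    by (metis lborel_affine)
  also have "\<dots> = ennreal (R ^ DIM('a)) * (\<integral>\<^sup>+x. F (R *\<^sub>R x) \<partial>lborel)"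
    using R by (simp add: nn_integral_density nn_integral_distr nn_integral_cmult)
  finally show ?thesis .
qed

lemma L2_scale:
  fixes f :: "'a::euclidean_space \<Rightarrow> real"
  assumes R: "R > 0" and [measurable]: "f \<in> borel_measurable borel"
  shows "(\<integral>\<^sup>+x. ennreal ((f (x /\<^sub>R R))\<^sup>2) \<partial>lborel) = ennreal (R ^ DIM('a)) * (\<integral>\<^sup>+x. ennreal ((f x)\<^sup>2) \<partial>lborel)"
proof -
  have "(\<integral>\<^sup>+x. ennreal ((f (x /\<^sub>R R))\<^sup>2) \<partial>lborel)
      = ennreal (R ^ DIM('a)) * (\<integral>\<^sup>+x. ennreal ((f ((R *\<^sub>R x) /\<^sub>R R))\<^sup>2) \<partial>lborel)"
    by (rule nn_integral_lborel_scale[OF R]) measurable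
  then show ?thesis
    using R by simp
qed

text \<open>The two changes of variables give \<open>R ^ n\<close> each, and the kernel gives
  \<open>R powr (- (n + 2 * s))\<close>. Relative to \<open>L2_scale\<close> a factor
  \<open>R powr (- 2 * s)\<close> is gained, so the quotient of a dilated function tends to
  0.\<close>

lemma gagliardo_scale:
  fixes f :: "'a::euclidean_space \<Rightarrow> real"
  assumes R: "R > 0" and [measurable]: "f \<in> borel_measurable borel"
  shows "(gagliardo_seminorm s (\<lambda>x. f (x /\<^sub>R R)))\<^sup>2
    = ennreal (R ^ DIM('a) * R powr (- 2 * s)) * (gagliardo_seminorm s f)\<^sup>2"
proof -
  define n where "n = DIM('a)"
  define C where "C = ennreal (C_const n s / 2)"
  define k where "k x y = \<bar>f x - f y\<bar>\<^sup>2 / norm (x - y) powr (real n + 2 * s)" for x y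
  have [measurable]: "case_prod k \<in> borel_measurable (borel \<Otimes>\<^sub>M borel)"
    unfolding k_def by measurable
  define g where "g x y = \<bar>f (x /\<^sub>R R) - f (y /\<^sub>R R)\<bar>\<^sup>2 / norm (x - y) powr (real n + 2 * s)" for x y
  have [measurable]: "case_prod g \<in> borel_measurable (borel \<Otimes>\<^sub>M borel)"
    unfolding g_def by measurable
  have g: "g (R *\<^sub>R x) (R *\<^sub>R y) = R powr (- (real n + 2 * s)) * k x y" for x y
  proof -
    have "norm (R *\<^sub>R x - R *\<^sub>R y) = R * norm (x - y)"
      using R by (simp flip: scaleR_diff_right)
    then show ?thesis
      using R unfolding g_def k_def powr_minus_divide by (simp add: powr_mult)
  qed
  have "(gagliardo_seminorm s (\<lambda>x. f (x /\<^sub>R R)))\<^sup>2 = C * (\<integral>\<^sup>+y. \<integral>\<^sup>+x. ennreal (g x y) \<partial>lborel \<partial>lborel)"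
    by (simp add: gagliardo_seminorm_def C_def n_def g_def)
  also have "(\<integral>\<^sup>+y. \<integral>\<^sup>+x. ennreal (g x y) \<partial>lborel \<partial>lborel)
      = ennreal (R ^ n) * (\<integral>\<^sup>+y. \<integral>\<^sup>+x. ennreal (g x (R *\<^sub>R y)) \<partial>lborel \<partial>lborel)"
    unfolding n_def by (rule nn_integral_lborel_scale[OF R]) measurable
  also have "\<dots> = ennreal (R ^ n) * (\<integral>\<^sup>+y. ennreal (R ^ n) * (\<integral>\<^sup>+x. ennreal (g (R *\<^sub>R x) (R *\<^sub>R y)) \<partial>lborel) \<partial>lborel)"
    unfolding n_def by (intro arg_cong2[where f="(*)"] refl nn_integral_cong nn_integral_lborel_scale[OF R]) measurable
  also have "C * \<dots> = C * (ennreal (R ^ n) * (\<integral>\<^sup>+y. ennreal (R ^ n) * (\<integral>\<^sup>+x. ennreal (R powr (- (real n + 2 * s))) * ennreal (k x y) \<partial>lborel) \<partial>lborel))"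
    unfolding g by (simp add: ennreal_mult')
  also have "\<dots> = (ennreal (R ^ n) * (ennreal (R ^ n) * ennreal (R powr (- (real n + 2 * s))))) * (C * (\<integral>\<^sup>+y. \<integral>\<^sup>+x. ennreal (k x y) \<partial>lborel \<partial>lborel))"
    by (simp add: nn_integral_cmult) (simp add: mult_ac)
  also have "C * (\<integral>\<^sup>+y. \<integral>\<^sup>+x. ennreal (k x y) \<partial>lborel \<partial>lborel) = (gagliardo_seminorm s f)\<^sup>2"
    by (simp add: gagliardo_seminorm_def C_def n_def k_def)
  also have "ennreal (R ^ n) * (ennreal (R ^ n) * ennreal (R powr (- (real n + 2 * s)))) = ennreal (R ^ n * R powr (- 2 * s))"
  proof -
    have "R ^ n * (R ^ n * R powr (- (real n + 2 * s))) = R ^ n * R powr (- 2 * s)"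
      using R by (simp add: powr_realpow[symmetric] powr_add[symmetric])
    then show ?thesis
      using R by (simp add: ennreal_mult[symmetric])
  qed
  finally show ?thesis
    by (simp add: n_def)
qed

subsection \<open>Cylinders\<close>

text \<open>Each slice of a test function on the cylinder is a test function on \<omega>. Apply the
  inequality there, integrate over the slices and compare with the full seminorm.\<close>

lemma poincare_sq_cylinder_ge:
  fixes \<omega> :: "'b::euclidean_space set"
  assumes \<omega>: "open \<omega>" and s: "0 < s" "s < 1"
  shows "poincare_sq s \<omega> \<le> poincare_sq s ((UNIV :: 'a::euclidean_space set) \<times> \<omega>)"
proof (rule poincare_sq_geI)
  show "open ((UNIV :: 'a set) \<times> \<omega>)"
    using \<omega> by (simp add: open_Times)
next
  fix \<phi> :: "'a \<times> 'b \<Rightarrow> real" assume \<phi>: "\<phi> \<in> Cc_infinity (UNIV \<times> \<omega>)"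
  note slice = Cc_infinity_slice[OF \<phi>]
  have meas: "\<phi> \<in> borel_measurable borel" by (rule Cc_infinity_measurable[OF \<phi>])
  then have [measurable]: "\<phi> \<in> borel_measurable (borel \<Otimes>\<^sub>M borel)" by (simp add: borel_prod)
  have "poincare_sq s \<omega> * L2_sq_on (UNIV \<times> \<omega>) \<phi>
      = poincare_sq s \<omega> * (\<integral>\<^sup>+x. \<integral>\<^sup>+y. ennreal ((\<phi> (x, y))\<^sup>2) \<partial>lborel \<partial>lborel)"
    unfolding Cc_infinity_L2_sq_on[OF \<phi>] using meas by (subst nn_integral_lborel_Pair) auto
  also have "\<dots> = (\<integral>\<^sup>+x. poincare_sq s \<omega> * L2_sq_on \<omega> (\<lambda>y. \<phi> (x, y)) \<partial>lborel)"
    by (simp add: nn_integral_cmult Cc_infinity_L2_sq_on[OF slice])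
  also have "\<dots> \<le> (\<integral>\<^sup>+x. (gagliardo_seminorm s (\<lambda>y. \<phi> (x, y)))\<^sup>2 \<partial>lborel)"
    by (intro nn_integral_mono poincare_sq_mult_le slice)
  also have "\<dots> \<le> (gagliardo_seminorm s \<phi>)\<^sup>2"
    by (intro gagliardo_slices_le s meas Cc_infinity_L2_finite[OF slice])
  finally show "poincare_sq s \<omega> * L2_sq_on (UNIV \<times> \<omega>) \<phi> \<le> (gagliardo_seminorm s \<phi>)\<^sup>2" .
qed

text \<open>Test the cylinder with the tensor product of \<psi> and a bump \<open>f\<close> dilated
  by \<open>R\<close>. After division by the squared norm of the dilated bump, the energy of the
  bump survives only as an error of order \<open>R powr (- 2 * s)\<close>.\<close>

lemma poincare_sq_cylinder_le:
  fixes \<omega> :: "'b::euclidean_space set"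
  assumes \<omega>: "open \<omega>" and s: "0 < s" "s < 1"
  shows "poincare_sq s ((UNIV :: 'a::euclidean_space set) \<times> \<omega>) \<le> poincare_sq s \<omega>"
proof (rule poincare_sq_geI[OF \<omega>])
  fix \<psi> :: "'b \<Rightarrow> real" assume \<psi>: "\<psi> \<in> Cc_infinity \<omega>"
  have [measurable]: "\<psi> \<in> borel_measurable borel" by (rule Cc_infinity_measurable[OF \<psi>])
  let ?P = "poincare_sq s ((UNIV :: 'a set) \<times> \<omega>)"
  show "?P * L2_sq_on \<omega> \<psi> \<le> (gagliardo_seminorm s \<psi>)\<^sup>2"
  \<comment> \<open>The bump on \<open>'a\<close> is transferred from \<psi> itself, so \<psi>
    identically zero is treated apart.\<close>
  proof (cases "\<exists>y. \<psi> y \<noteq> 0")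
    case False
    then show ?thesis by (simp add: L2_sq_on_def)
  next
    case True
    then obtain f :: "'a \<Rightarrow> real" and x0 where f: "f \<in> Cc_infinity UNIV" "f x0 \<noteq> 0"
      using Cc_infinity_nonzero_transfer[OF \<psi>] by metis
    have [measurable]: "f \<in> borel_measurable borel" by (rule Cc_infinity_measurable[OF f(1)])
    define N where "N = (\<integral>\<^sup>+x. ennreal ((f x)\<^sup>2) \<partial>lborel)"
    have N: "N < top" unfolding N_def by (rule Cc_infinity_L2_finite[OF f(1)])
    \<comment> \<open>The zero set of \<open>f\<close> is closed; if its complement were null, it
      would contain \<open>x0\<close>.\<close>
    have N0: "N \<noteq> 0"
    proof
      assume "N = 0"
      then have "AE x in lebesgue. x \<in> {x. f x = 0}"
        unfolding N_def by (subst (asm) nn_integral_0_iff_AE) (auto intro: AE_completion)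
      moreover have "closed {x. f x = 0}"
        using Cc_infinity_continuous[OF f(1)] by (intro closed_Collect_eq) auto
      ultimately have "x0 \<in> {x. f x = 0}"
        by (intro mem_closed_if_AE_lebesgue)
      then show False using f(2) by blast
    qed
    define G where "G = (gagliardo_seminorm s f)\<^sup>2"
    have G: "G < top" unfolding G_def by (rule Cc_infinity_gagliardo_finite[OF s f(1)])
    define l where "l = L2_sq_on \<omega> \<psi>"
    have l: "l = (\<integral>\<^sup>+x. ennreal ((\<psi> x)\<^sup>2) \<partial>lborel)" "l < top"
      unfolding l_def using Cc_infinity_L2_sq_on[OF \<psi>] Cc_infinity_L2_finite[OF \<psi>] by auto
    have bound: "?P * l \<le> (gagliardo_seminorm s \<psi>)\<^sup>2 + ennreal (R powr (- 2 * s)) * (l * G / N)" if R: "R > 0" for R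
    proof -
      define fR where "fR x = f (x /\<^sub>R R)" for x
      have fR: "fR \<in> Cc_infinity UNIV"
        unfolding fR_def[abs_def] by (rule Cc_infinity_scale[OF f(1) R])
      have [measurable]: "fR \<in> borel_measurable borel" by (rule Cc_infinity_measurable[OF fR])
      define r where "r = ennreal (R ^ DIM('a))"
      have r: "r \<noteq> 0" "r < top" using R by (simp_all add: r_def)
      have rN: "N * r \<noteq> 0" "N * r \<noteq> top"
        using r N N0 by (auto simp: ennreal_mult_eq_top_iff)
      have L2: "(\<integral>\<^sup>+x. ennreal ((fR x)\<^sup>2) \<partial>lborel) = r * N"
        unfolding fR_def r_def N_def by (rule L2_scale[OF R]) simp
      have Gs: "(gagliardo_seminorm s fR)\<^sup>2 = r * (ennreal (R powr (- 2 * s)) * G)"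
        unfolding fR_def[abs_def] r_def G_def using R
        by (subst gagliardo_scale[OF R]) (simp_all add: ennreal_mult mult_ac)
      note T = Cc_infinity_tensor[OF fR \<psi>]
      have "L2_sq_on (UNIV \<times> \<omega>) (\<lambda>(x, y). fR x * \<psi> y)
          = (\<integral>\<^sup>+x. \<integral>\<^sup>+y. ennreal ((fR x)\<^sup>2) * ennreal ((\<psi> y)\<^sup>2) \<partial>lborel \<partial>lborel)"
        unfolding Cc_infinity_L2_sq_on[OF T] using Cc_infinity_measurable[OF T]
        by (subst nn_integral_lborel_Pair) (auto simp: power_mult_distrib ennreal_mult)
      also have "\<dots> = r * N * l"
        by (simp add: nn_integral_cmult nn_integral_multc L2 l(1))
      finally have "?P * (r * N * l) \<le> (gagliardo_seminorm s (\<lambda>(x, y). fR x * \<psi> y))\<^sup>2"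
        using poincare_sq_mult_le[OF T, of s] by simp
      also have "\<dots> \<le> r * N * (gagliardo_seminorm s \<psi>)\<^sup>2 + l * (r * (ennreal (R powr (- 2 * s)) * G))"
        using gagliardo_tensor_le[OF s, of fR \<psi>] by (simp add: L2 Gs l(1))
      \<comment> \<open>Divide by \<open>r * N\<close>, the squared norm of \<open>fR\<close>. The
        volume factor \<open>r\<close> occurs in every term and cancels.\<close>
      finally have "?P * l * (r * N) / (r * N) \<le> ((gagliardo_seminorm s \<psi>)\<^sup>2 * (r * N) + ennreal (R powr (- 2 * s)) * (l * G) * r) / (r * N)"
        by (intro divide_right_mono_ennreal) (simp add: mult_ac)
      also have "\<dots> = (gagliardo_seminorm s \<psi>)\<^sup>2 + ennreal (R powr (- 2 * s)) * (l * G) * r / (N * r)"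
        unfolding mult.commute[of r N] add_divide_distrib_ennreal mult_divide_eq_ennreal[OF rN] ..
      also have "ennreal (R powr (- 2 * s)) * (l * G) * r / (N * r) = ennreal (R powr (- 2 * s)) * (l * G / N)"
        using r by (simp add: divide_mult_eq ennreal_times_divide)
      also have "?P * l * (r * N) / (r * N) = ?P * l"
        unfolding mult.commute[of r N] mult_divide_eq_ennreal[OF rN] ..
      finally show ?thesis .
    qed
    have "l * G / N \<noteq> top"
      using l(2) G N0 by (auto simp: ennreal_divide_eq_top_iff ennreal_mult_eq_top_iff)
    then obtain c where c: "c \<ge> 0" "l * G / N = ennreal c"
      by (metis ennreal_cases)
    have "?P * l \<le> (gagliardo_seminorm s \<psi>)\<^sup>2"
    proof (rule ennreal_le_epsilon)
      fix e :: real assume e: "0 < e"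
      \<comment> \<open>Chosen to give \<open>R powr (- 2 * s) = e / (c + 1)\<close>; the added 1
        keeps the base positive and the quotient defined when \<open>c = 0\<close>.\<close>
      define R where "R = ((c + 1) / e) powr (1 / (2 * s))"
      have R: "R > 0" using c e by (simp add: R_def)
      have "R powr (- 2 * s) = e / (c + 1)"
        using c e s by (simp add: R_def powr_powr powr_minus)
      moreover have "e / (c + 1) * c \<le> e"
        using c e by (simp add: field_simps)
      ultimately have "R powr (- 2 * s) * c \<le> e"
        by simp
      then have "ennreal (R powr (- 2 * s)) * (l * G / N) \<le> ennreal e"
        unfolding c(2) using c by (simp add: ennreal_mult[symmetric] ennreal_leI)
      then show "?P * l \<le> (gagliardo_seminorm s \<psi>)\<^sup>2 + ennreal e"
        using bound[OF R] by (meson add_left_mono order_trans)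
    qed
    then show ?thesis by (simp add: l_def)
  qed
qed

theorem theorem1p2:
  fixes \<omega> :: "'b::euclidean_space set" and s :: real
  assumes "open \<omega>" and "bounded \<omega>" and "0 < s" and "s < 1"
  shows "poincare_sq s ((UNIV :: 'a::euclidean_space set) \<times> \<omega>) = poincare_sq s \<omega>"
  using poincare_sq_cylinder_ge[OF assms(1,3,4)] poincare_sq_cylinder_le[OF assms(1,3,4)]
  by (rule antisym[rotated])

end
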